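(* There exist universal constants $c,C,c_\epsilon>0$ and $d_0\in\mathbb N$ such that, whenever $d\ge d_0$, $R>0$, $0<\mu\le\beta$, and, with $\kappa=\beta/\mu$, $$\kappa\le\left(\frac{d}{\log(ed)}\right)^{2/3},\qquad 0<\epsilon\le c_\epsilon\mu R^2,$$ one has $$c\,d\sqrt\kappa\le N_\epsilon(d,R,\mu,\beta)\le C\,d\sqrt\kappa\left[1+\log\frac{\mu R^2}{\epsilon}\right].$$ Consequently $N_\epsilon(d,R,\mu,\beta)=\widetilde\Theta(d\sqrt\kappa)$ throughout this region, where the suppressed factor is logarithmic only in $\mu R^2/\epsilon$.
   Context: $B_2^d(r)$ is the closed Euclidean ball of radius $r$ centred at $0$ in $\mathbb R^d$; $X:=B_2^d(R)$. Class $\mathcal F_{\mu,\beta}(d,R)$: all continuously differentiable $f:\mathbb R^d\to\mathbb R$ such that for all $x,y\in\mathbb R^d$, $f(y)\ge f(x)+\langle\nabla f(x),y-x\rangle+\frac\mu2\|y-x\|_2^2$ and $\|\nabla f(x)-\nabla f(y)\|_2\le\beta\|x-y\|_2$, and whose unique minimizer $x_f^\star$ lies in $B_2^d(R/2)$. Write $f^\star=f(x_f^\star)$. A deterministic adaptive algorithm with budget $T$ (a $T$-call algorithm) consists of Borel maps $Q_t:(X\times\mathbb R)^{t-1}\to X$, $t=1,\dots,T$, and a Borel terminal map $Q_{\mathrm{out}}:(X\times\mathbb R)^T\to X$. On a fixed objective $f$ it generates recursively $x_t=Q_t((x_1,f(x_1)),\dots,(x_{t-1},f(x_{t-1})))$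 and outputs $\widehat x_f=Q_{\mathrm{out}}((x_1,f(x_1)),\dots,(x_T,f(x_T)))$. Minimax exact-value complexity: $N_\epsilon(d,R,\mu,\beta)$ is the infimum of all $T\in\mathbb N_0$ for which there exists a deterministic adaptive $T$-call algorithm with $\sup_{f\in\mathcal F_{\mu,\beta}(d,R)}[f(\widehat x_f)-f^\star]\le\epsilon$ (with $\inf\varnothing=+\infty$). The final $\widetilde\Theta$ sentence is exactly a restatement of the displayed two-sided bound. *)

theory Defs
  imports "HOL-Analysis.Analysis"
begin

text \<open>
  The dimension is quantified inside the statement, so \<open>\<real>\<^sup>d\<close> is the library's
  \<^term>\<open>Euclidean_space d\<close>: functions \<^typ>\<open>nat \<Rightarrow> real\<close> vanishing at all indices \<open>\<ge> d\<close>.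
  Its Borel sets are the traces of the Borel sets of the product topology on
  \<^typ>\<open>nat \<Rightarrow> real\<close>.
\<close>

abbreviation Rn :: "nat \<Rightarrow> (nat \<Rightarrow> real) set" where
  "Rn d \<equiv> topspace (Euclidean_space d)"

definition inner_Rn :: "nat \<Rightarrow> (nat \<Rightarrow> real) \<Rightarrow> (nat \<Rightarrow> real) \<Rightarrow> real" where
  "inner_Rn d x y = (\<Sum>i<d. x i * y i)"

definition norm_Rn :: "nat \<Rightarrow> (nat \<Rightarrow> real) \<Rightarrow> real" where
  "norm_Rn d x = L2_set x {..<d}"

definition ball2 :: "nat \<Rightarrow> real \<Rightarrow> (nat \<Rightarrow> real) set" where
  "ball2 d r = {x \<in> Rn d. norm_Rn d x \<le> r}"

text \<open>Frechet differentiability of \<open>f\<close> at \<open>x\<close>, with gradient \<open>g\<close>. Subtraction of vectors is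
  the pointwise subtraction of functions.\<close>

definition has_gradient_Rn ::
  "nat \<Rightarrow> ((nat \<Rightarrow> real) \<Rightarrow> real) \<Rightarrow> (nat \<Rightarrow> real) \<Rightarrow> (nat \<Rightarrow> real) \<Rightarrow> bool" where
  "has_gradient_Rn d f g x \<longleftrightarrow> g \<in> Rn d \<and>
     (\<forall>e>0. \<exists>\<delta>>0. \<forall>y\<in>Rn d. norm_Rn d (y - x) < \<delta> \<longrightarrow>
        \<bar>f y - f x - inner_Rn d g (y - x)\<bar> \<le> e * norm_Rn d (y - x))"

definition min_value :: "nat \<Rightarrow> ((nat \<Rightarrow> real) \<Rightarrow> real) \<Rightarrow> real" where
  "min_value d f = f (arg_min_on f (Rn d))"

text \<open>Membership constrains \<open>f\<close> only on \<^term>\<open>Rn d\<close>; the values of \<open>f\<close> elsewhere are never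
  used.\<close>

definition obj_class :: "nat \<Rightarrow> real \<Rightarrow> real \<Rightarrow> real \<Rightarrow> ((nat \<Rightarrow> real) \<Rightarrow> real) set" where
  "obj_class d R \<mu> \<beta> = {f.
     (\<exists>G. (\<forall>x\<in>Rn d. has_gradient_Rn d f (G x) x) \<and>
          continuous_map (Euclidean_space d) (Euclidean_space d) G \<and>
          (\<forall>x\<in>Rn d. \<forall>y\<in>Rn d.
             f y \<ge> f x + inner_Rn d (G x) (y - x) + \<mu> / 2 * (norm_Rn d (y - x))\<^sup>2 \<and>
             norm_Rn d (G x - G y) \<le> \<beta> * norm_Rn d (x - y))) \<and>
     (\<exists>!x. is_arg_min f (\<lambda>x. x \<in> Rn d) x) \<and>
     arg_min_on f (Rn d) \<in> ball2 d (R / 2)}"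

type_synonym transcript = "nat \<Rightarrow> (nat \<Rightarrow> real) \<times> real"

definition query_space :: "nat \<Rightarrow> real \<Rightarrow> (nat \<Rightarrow> real) measure" where
  "query_space d R = restrict_space borel (ball2 d R)"

text \<open>\<open>(X \<times> \<real>)\<^sup>t\<close> with its Borel sets, as a finite product; transcripts of length \<open>t\<close> are
  \<open>undefined\<close> at indices \<open>\<ge> t\<close>.\<close>

definition transcript_space :: "nat \<Rightarrow> real \<Rightarrow> nat \<Rightarrow> transcript measure" where
  "transcript_space d R t = PiM {..<t} (\<lambda>_. query_space d R \<Otimes>\<^sub>M borel)"

text \<open>Queries are numbered from 0, so that \<open>Q t\<close> reads a transcript of length \<open>t\<close>.\<close>

definition algorithm ::
  "nat \<Rightarrow> real \<Rightarrow> nat \<Rightarrow> (nat \<Rightarrow> transcript \<Rightarrow> nat \<Rightarrow> real) \<Rightarrow> (transcript \<Rightarrow> nat \<Rightarrow> real) \<Rightarrow> bool"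
  where
  "algorithm d R T Q Qout \<longleftrightarrow>
     (\<forall>t<T. Q t \<in> transcript_space d R t \<rightarrow>\<^sub>M query_space d R) \<and>
     Qout \<in> transcript_space d R T \<rightarrow>\<^sub>M query_space d R"

primrec run ::
  "(nat \<Rightarrow> transcript \<Rightarrow> nat \<Rightarrow> real) \<Rightarrow> ((nat \<Rightarrow> real) \<Rightarrow> real) \<Rightarrow> nat \<Rightarrow> transcript" where
  "run Q f 0 = (\<lambda>_. undefined)"
| "run Q f (Suc t) = (let h = run Q f t; x = Q t h in h(t := (x, f x)))"

definition exact_value_complexity ::
  "nat \<Rightarrow> real \<Rightarrow> real \<Rightarrow> real \<Rightarrow> real \<Rightarrow> enat" where
  "exact_value_complexity d R \<mu> \<beta> \<epsilon> =
     Inf {enat T | T. \<exists>Q Qout. algorithm d R T Q Qout \<and>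
       (SUP f\<in>obj_class d R \<mu> \<beta>. ereal (f (Qout (run Q f T)) - min_value d f)) \<le> ereal \<epsilon>}"

end

theory Submission
  imports Defs
begin

text \<open>
  Lower bound. For bounded condition number the objectives \<open>\<mu> / 2 * \<parallel>x - p\<parallel>\<^sup>2\<close> already cost \<open>d - 1\<close>
  queries. Otherwise the hard objective is a Nesterov chain of length of order \<open>sqrt \<kappa>\<close> in the
  coordinates \<open>\<langle>v l, x\<rangle>\<close> along orthonormal directions \<open>v l\<close>, in which differences of consecutive
  coordinates below a threshold \<open>\<delta>\<close> cost nothing. Direction \<open>l\<close> is chosen only after \<open>d / 8\<close>
  queries made while \<open>v 0, \<dots>, v (l - 1)\<close> were known: orthogonal to these queries, and within the
  dead zone for all earlier ones, so that it is consistent with every answer given before. A random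
  direction does this as long as \<open>\<delta> / R\<close>, of order \<open>\<kappa> powr (- 3 / 4)\<close>, exceeds
  \<open>sqrt (ln d / d)\<close>; this is where the bound on \<open>\<kappa>\<close> comes from. The output is orthogonal to the
  second half of the directions, along which the minimiser has a constant fraction of its mass.

  Upper bound. Exact values give arbitrarily accurate gradients from \<open>d + 1\<close> queries. An accelerated
  projected method restarted every \<open>8 * sqrt \<kappa>\<close> steps divides the squared distance to the minimiser by
  four in each epoch; restarting is what keeps \<open>ln \<kappa>\<close> out of the bound.
\<close>

section \<open>Euclidean geometry of \<open>Rn\<close>\<close>

lemma Rn_iff: "x \<in> Rn d \<longleftrightarrow> (\<forall>i\<ge>d. x i = 0)"
  by (simp add: topspace_Euclidean_space)

lemma Rn_eqI:
  assumes "x \<in> Rn d" "y \<in> Rn d" "\<And>i. i < d \<Longrightarrow> x i = y i"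
  shows "x = y"
  using assms unfolding Rn_iff by (metis ext leI)

lemma inner_Rn_commute: "inner_Rn d x y = inner_Rn d y x"
  by (simp add: inner_Rn_def mult.commute)

lemma inner_Rn_diff_right: "inner_Rn d x (y - z) = inner_Rn d x y - inner_Rn d x z"
  by (simp add: inner_Rn_def algebra_simps sum_subtractf)

lemma inner_Rn_diff_left: "inner_Rn d (y - z) x = inner_Rn d y x - inner_Rn d z x"
  by (simp add: inner_Rn_def algebra_simps sum_subtractf)

lemma inner_Rn_add_right: "inner_Rn d x (\<lambda>i. y i + z i) = inner_Rn d x y + inner_Rn d x z"
  by (simp add: inner_Rn_def algebra_simps sum.distrib)

lemma inner_Rn_add_left: "inner_Rn d (\<lambda>i. y i + z i) x = inner_Rn d y x + inner_Rn d z x"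
  by (simp add: inner_Rn_def algebra_simps sum.distrib)

lemma inner_Rn_scale_right: "inner_Rn d x (\<lambda>i. c * y i) = c * inner_Rn d x y"
  by (simp add: inner_Rn_def algebra_simps sum_distrib_left)

lemma inner_Rn_scale_left: "inner_Rn d (\<lambda>i. c * y i) x = c * inner_Rn d y x"
  by (simp add: inner_Rn_def algebra_simps sum_distrib_left)

lemma inner_Rn_sum_right: "inner_Rn d x (\<lambda>i. \<Sum>l\<in>A. y l i) = (\<Sum>l\<in>A. inner_Rn d x (y l))"
  unfolding inner_Rn_def sum_distrib_left by (rule sum.swap)

lemma inner_Rn_sum_left: "inner_Rn d (\<lambda>i. \<Sum>l\<in>A. y l i) x = (\<Sum>l\<in>A. inner_Rn d (y l) x)"
  unfolding inner_Rn_def sum_distrib_right by (rule sum.swap)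

lemmas inner_Rn_simps = inner_Rn_diff_right inner_Rn_diff_left inner_Rn_add_right
  inner_Rn_add_left inner_Rn_scale_right inner_Rn_scale_left

lemma norm_Rn_nonneg [simp]: "0 \<le> norm_Rn d x"
  by (simp add: norm_Rn_def)

lemma norm_Rn_power2: "(norm_Rn d x)\<^sup>2 = inner_Rn d x x"
  by (simp add: norm_Rn_def inner_Rn_def L2_set_def sum_nonneg power2_eq_square)

lemma inner_Rn_self_nonneg [simp]: "0 \<le> inner_Rn d x x"
  by (metis norm_Rn_power2 zero_le_power2)

lemma norm_Rn_le_iff: "0 \<le> r \<Longrightarrow> norm_Rn d x \<le> r \<longleftrightarrow> inner_Rn d x x \<le> r\<^sup>2"
  by (metis abs_le_square_iff abs_of_nonneg norm_Rn_nonneg norm_Rn_power2)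

lemma norm_Rn_eq_0D: "norm_Rn d x = 0 \<Longrightarrow> i < d \<Longrightarrow> x i = 0"
  by (simp add: norm_Rn_def L2_set_eq_0_iff)

lemma inner_Rn_le_norm: "\<bar>inner_Rn d x y\<bar> \<le> norm_Rn d x * norm_Rn d y"
proof -
  have "\<bar>inner_Rn d x y\<bar> \<le> (\<Sum>i<d. \<bar>x i\<bar> * \<bar>y i\<bar>)"
    unfolding inner_Rn_def by (rule order_trans[OF sum_abs]) (simp add: abs_mult)
  also have "\<dots> \<le> norm_Rn d x * norm_Rn d y"
    unfolding norm_Rn_def by (rule L2_set_mult_ineq)
  finally show ?thesis .
qed

lemma norm_Rn_add: "norm_Rn d (\<lambda>i. x i + y i) \<le> norm_Rn d x + norm_Rn d y"
  unfolding norm_Rn_def by (rule L2_set_triangle_ineq)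

lemma norm_Rn_scale: "norm_Rn d (\<lambda>i. c * x i) = \<bar>c\<bar> * norm_Rn d x"
proof (rule power2_eq_imp_eq)
  show "(norm_Rn d (\<lambda>i. c * x i))\<^sup>2 = (\<bar>c\<bar> * norm_Rn d x)\<^sup>2"
    unfolding power_mult_distrib norm_Rn_power2 inner_Rn_simps by (simp add: power2_eq_square)
qed auto

lemma norm_Rn_diff_le: "norm_Rn d (x - y) \<le> norm_Rn d x + norm_Rn d y"
  using norm_Rn_add[of d x "\<lambda>i. (-1) * y i"] norm_Rn_scale[of d "-1" y]
  by (simp add: fun_diff_def)

lemma abs_le_norm_Rn: "i < d \<Longrightarrow> \<bar>x i\<bar> \<le> norm_Rn d x"
  using member_le_L2_set[of "{..<d}" i "\<lambda>i. \<bar>x i\<bar>"] by (simp add: norm_Rn_def L2_set_def)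

section \<open>Orthonormal families and Bessel's inequality\<close>

definition orthonormal_Rn :: "nat \<Rightarrow> nat \<Rightarrow> (nat \<Rightarrow> nat \<Rightarrow> real) \<Rightarrow> bool" where
  "orthonormal_Rn d k v \<longleftrightarrow>
     (\<forall>i<k. v i \<in> Rn d \<and> (\<forall>j<k. inner_Rn d (v i) (v j) = (if i = j then 1 else 0)))"

lemma inner_Rn_orthonormal_sum:
  assumes "orthonormal_Rn d k v" "i < k"
  shows "inner_Rn d (v i) (\<lambda>r. \<Sum>l<k. c l * v l r) = c i"
proof -
  have "inner_Rn d (v i) (\<lambda>r. \<Sum>l<k. c l * v l r) = (\<Sum>l<k. if i = l then c l else 0)"
    unfolding inner_Rn_sum_right inner_Rn_scale_right
    by (rule sum.cong) (use assms in \<open>auto simp: orthonormal_Rn_def\<close>)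
  then show ?thesis using assms(2) by simp
qed

text \<open>The orthogonal projection \<open>?p\<close> of \<open>x\<close> onto the span has the
  same inner product with \<open>x\<close> as with itself, so the squared norm of
  \<open>x - ?p\<close> is the difference of the two sides.\<close>

lemma bessel_Rn:
  assumes "orthonormal_Rn d k v"
  shows "(\<Sum>l<k. (inner_Rn d (v l) x)\<^sup>2) \<le> inner_Rn d x x"
proof -
  let ?p = "\<lambda>r. \<Sum>l<k. inner_Rn d (v l) x * v l r"
  have px: "inner_Rn d ?p x = (\<Sum>l<k. (inner_Rn d (v l) x)\<^sup>2)"
    by (simp add: inner_Rn_sum_left inner_Rn_scale_left power2_eq_square)
  have "inner_Rn d ?p ?p = (\<Sum>l<k. inner_Rn d (v l) x * inner_Rn d (v l) ?p)"
    by (simp add: inner_Rn_sum_left[of d _ _ ?p] inner_Rn_scale_left)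
  also have "\<dots> = (\<Sum>l<k. (inner_Rn d (v l) x)\<^sup>2)"
    by (rule sum.cong) (simp_all add: inner_Rn_orthonormal_sum[OF assms] power2_eq_square)
  finally have pp: "inner_Rn d ?p ?p = (\<Sum>l<k. (inner_Rn d (v l) x)\<^sup>2)" .
  have "0 \<le> inner_Rn d (x - ?p) (x - ?p)" by simp
  also have "\<dots> = inner_Rn d x x - (\<Sum>l<k. (inner_Rn d (v l) x)\<^sup>2)"
    using px pp by (simp only: inner_Rn_diff_left inner_Rn_diff_right inner_Rn_commute[of d x ?p])
  finally show ?thesis by simp
qed

section \<open>Unit vectors orthogonal to some points and nearly orthogonal to others\<close>

text \<open>Gaussian elimination, by induction on the number of equations: either the last equation
  is vacuous, or it is solved for one unknown, which leaves \<open>m\<close> equations in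
  \<open>d - 1\<close> unknowns.\<close>

lemma homogeneous_system_nontrivial:
  fixes a :: "nat \<Rightarrow> nat \<Rightarrow> real"
  assumes "m < d"
  shows "\<exists>x\<in>Rn d. (\<exists>i<d. x i \<noteq> 0) \<and> (\<forall>j<m. inner_Rn d (a j) x = 0)"
  using assms
proof (induction m arbitrary: d a)
  case 0
  then show ?case
    by (intro bexI[of _ "\<lambda>i. if i = 0 then 1 else 0"]) (auto simp: Rn_iff)
next
  case (Suc m)
  show ?case
  proof (cases "\<exists>p<d. a m p \<noteq> 0")
    case False
    then have "inner_Rn d (a m) x = 0" for x by (simp add: inner_Rn_def)
    moreover obtain x where "x \<in> Rn d" "\<exists>i<d. x i \<noteq> 0" "\<forall>j<m. inner_Rn d (a j) x = 0"
      using Suc.IH[of d a] Suc.prems by auto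
    ultimately show ?thesis by (auto simp: less_Suc_eq)
  next
    case True
    then obtain p where p: "p < d" "a m p \<noteq> 0" by blast
    obtain d' where d: "d = Suc d'" using Suc.prems by (cases d) auto
    \<comment> \<open>\<open>s\<close> enumerates the indices other than the pivot
      \<open>p\<close>.\<close>
    define s where "s i = (if i < p then i else Suc i)" for i :: nat
    have bij: "bij_betw s {..<d'} ({..<d} - {p})"
      unfolding d using p(1) d
      by (intro bij_betw_byWitness[where f' = "\<lambda>i. if i < p then i else i - 1"])
         (auto simp: s_def)
    have split: "(\<Sum>i<d. g i) = g p + (\<Sum>i<d'. g (s i))" for g :: "nat \<Rightarrow> real"
      using sum.reindex_bij_betw[OF bij, of g] p(1)
      by (simp add: sum.remove[of "{..<d}" p])
    \<comment> \<open>Row \<open>j\<close> after subtracting the multiple of row \<open>m\<close>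
      that cancels column \<open>p\<close>. Back substitution into row \<open>m\<close> then forces
      the value \<open>t\<close> at \<open>p\<close>.\<close>
    define b where "b j i = a j (s i) - a j p / a m p * a m (s i)" for j i
    obtain z where z: "z \<in> Rn d'" "\<exists>i<d'. z i \<noteq> 0" "\<forall>j<m. inner_Rn d' (b j) z = 0"
      using Suc.IH[of d' b] Suc.prems d by auto
    define t where "t = - (\<Sum>i<d'. a m (s i) * z i) / a m p"
    define x where "x i = (if i = p then t else if i < p then z i else z (i - 1))" for i
    have xs: "x (s i) = z i" for i by (auto simp: x_def s_def)
    have xp: "x p = t" by (simp add: x_def)
    have m0: "inner_Rn d (a m) x = 0"
      unfolding inner_Rn_def split[of "\<lambda>i. a m i * x i"] xs xp using p by (simp add: t_def)
    have "inner_Rn d (a j) x = 0" if "j < m" for j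
    proof -
      have "0 = (\<Sum>i<d'. a j (s i) * z i) - a j p / a m p * (\<Sum>i<d'. a m (s i) * z i)"
        using z(3) that
        by (simp add: inner_Rn_def b_def algebra_simps sum_subtractf sum_distrib_left)
      then show ?thesis
        unfolding inner_Rn_def split[of "\<lambda>i. a j i * x i"] xs xp by (simp add: t_def)
    qed
    moreover have "\<exists>i<d. x i \<noteq> 0"
      using z(2) xs bij by (metis Diff_iff bij_betwE lessThan_iff)
    moreover have "x \<in> Rn d" using z(1) p d by (auto simp: Rn_iff x_def)
    ultimately show ?thesis using m0 by (auto simp: less_Suc_eq)
  qed
qed

lemma exists_unit_orthogonal:
  assumes "finite S" "card S < d"
  shows "\<exists>v\<in>Rn d. inner_Rn d v v = 1 \<and> (\<forall>s\<in>S. inner_Rn d v s = 0)"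
proof -
  obtain e where e: "bij_betw e {..<card S} S"
    using ex_bij_betw_nat_finite[OF assms(1)] by (auto simp: atLeast0LessThan)
  obtain x where x: "x \<in> Rn d" "\<exists>i<d. x i \<noteq> 0" "\<forall>j<card S. inner_Rn d (e j) x = 0"
    using homogeneous_system_nontrivial[OF assms(2)] by blast
  define N where "N = norm_Rn d x"
  have "N \<noteq> 0" using x(2) norm_Rn_eq_0D unfolding N_def by blast
  have S: "inner_Rn d x s = 0" if "s \<in> S" for s
    using x(3) that e by (metis bij_betw_imp_surj_on imageE inner_Rn_commute lessThan_iff)
  show ?thesis
  proof (intro bexI conjI ballI)
    show "(\<lambda>i. (1 / N) * x i) \<in> Rn d" using x(1) by (simp add: Rn_iff)
    show "inner_Rn d (\<lambda>i. (1 / N) * x i) (\<lambda>i. (1 / N) * x i) = 1"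
      using \<open>N \<noteq> 0\<close> by (simp only: inner_Rn_simps norm_Rn_power2[symmetric] flip: N_def)
        (simp add: power2_eq_square)
    show "inner_Rn d (\<lambda>i. (1 / N) * x i) s = 0" if "s \<in> S" for s
      using S[OF that] by (simp only: inner_Rn_simps)
  qed
qed

text \<open>Unit vectors are added one at a time; each has to be orthogonal to \<open>S\<close> and
  to its predecessors, which are fewer than \<open>d\<close> conditions.\<close>

lemma exists_orthonormal_in_complement:
  assumes "finite S" "card S + n \<le> d"
  shows "\<exists>w. orthonormal_Rn d n w \<and> (\<forall>i<n. \<forall>s\<in>S. inner_Rn d (w i) s = 0)"
  using assms(2)
proof (induction n)
  case 0
  then show ?case by (simp add: orthonormal_Rn_def)
next
  case (Suc n)
  then obtain w where w: "orthonormal_Rn d n w" "\<forall>i<n. \<forall>s\<in>S. inner_Rn d (w i) s = 0" by auto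
  have "card (S \<union> w ` {..<n}) \<le> card S + n"
    by (rule order_trans[OF card_Un_le]) (use card_image_le[of "{..<n}" w] in auto)
  then obtain u where u: "u \<in> Rn d" "inner_Rn d u u = 1" "\<forall>s\<in>S \<union> w ` {..<n}. inner_Rn d u s = 0"
    using exists_unit_orthogonal[of "S \<union> w ` {..<n}" d] assms(1) Suc.prems by auto
  have u': "inner_Rn d (w i) u = 0" if "i < n" for i
    using u(3) that by (subst inner_Rn_commute) auto
  show ?case
    by (rule exI[of _ "w(n := u)"])
       (use w u u' in \<open>auto simp: orthonormal_Rn_def less_Suc_eq\<close>)
qed

text \<open>The power series are compared term by term, using n! 2^n \<le> (2n)!. This is the
  subgaussian bound for a single random sign.\<close>

lemma cosh_le_exp_power2_half:
  fixes x :: real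
  shows "cosh x \<le> exp (x\<^sup>2 / 2)"
proof -
  have f: "fact n * (2::real) ^ n \<le> fact (2 * n)" for n :: nat
  proof (induction n)
    case (Suc n)
    have "fact (Suc n) * (2::real) ^ Suc n = (2 * real (Suc n)) * (fact n * 2 ^ n)"
      by (simp add: algebra_simps)
    also have "\<dots> \<le> (2 * real (Suc n)) * fact (2 * n)" using Suc by (intro mult_left_mono) auto
    also have "\<dots> \<le> (2 * real (Suc n)) * (real (Suc (2 * n)) * fact (2 * n))"
      by (intro mult_left_mono) (auto simp: algebra_simps)
    also have "\<dots> = fact (2 * Suc n)" by (simp add: algebra_simps)
    finally show ?case .
  qed simp
  have c: "(\<lambda>n. if even n then x ^ n /\<^sub>R fact n else 0) sums cosh x"
    using cosh_converges[of x] by simp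
  have "(\<lambda>n. x ^ (2 * n) /\<^sub>R fact (2 * n)) sums cosh x"
  proof -
    have "strict_mono (\<lambda>n::nat. 2 * n)" by (simp add: strict_mono_def)
    then have "(\<lambda>n. (\<lambda>n. if even n then x ^ n /\<^sub>R fact n else 0) (2 * n)) sums cosh x"
      by (subst sums_mono_reindex) (use c in \<open>auto elim!: evenE\<close>)
    then show ?thesis by simp
  qed
  moreover have "(\<lambda>n. (x\<^sup>2 / 2) ^ n /\<^sub>R fact n) sums exp (x\<^sup>2 / 2)"
    by (rule exp_converges)
  moreover have "x ^ (2 * n) /\<^sub>R fact (2 * n) \<le> (x\<^sup>2 / 2) ^ n /\<^sub>R fact n" for n
  proof -
    have "x ^ (2 * n) / fact (2 * n) \<le> x ^ (2 * n) / (fact n * 2 ^ n)"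
      using f[of n] by (intro divide_left_mono) auto
    also have "\<dots> = (x\<^sup>2 / 2) ^ n / fact n"
      by (simp add: power_mult power_divide mult.commute[of "fact n"])
    finally show ?thesis by (simp only: scaleR_conv_of_real of_real_inverse of_real_fact of_real_eq_id id_apply divide_inverse mult.commute)
  qed
  ultimately show ?thesis by (rule sums_le[rotated 1]) 
qed

text \<open>Hoeffding's inequality for random signs, derandomised by the method of conditional
  expectations.\<close>

lemma exists_signs_cosh_sum_le:
  fixes a :: "nat \<Rightarrow> 'a \<Rightarrow> real"
  assumes "\<And>t. 0 \<le> g t"
  shows "\<exists>\<sigma>. (\<forall>i. \<sigma> i = 1 \<or> \<sigma> i = - 1) \<and>
    (\<Sum>t\<in>A. g t * cosh (\<Sum>i<n. \<sigma> i * a i t)) \<le> (\<Sum>t\<in>A. g t * exp (\<Sum>i<n. (a i t)\<^sup>2 / 2))"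
  using assms
proof (induction n arbitrary: g)
    case 0
    then show ?case by (auto intro!: exI[of _ "\<lambda>_. 1"])
  next
    case (Suc n)
    \<comment> \<open>The factor due to sign \<open>n\<close> is averaged out in advance and
      absorbed into the weights, which is why the statement carries a general
      \<open>g\<close>.\<close>
    obtain \<sigma> where \<sigma>: "\<forall>i. \<sigma> i = 1 \<or> \<sigma> i = - (1::real)"
      "(\<Sum>t\<in>A. (g t * exp ((a n t)\<^sup>2 / 2)) * cosh (\<Sum>i<n. \<sigma> i * a i t))
        \<le> (\<Sum>t\<in>A. (g t * exp ((a n t)\<^sup>2 / 2)) * exp (\<Sum>i<n. (a i t)\<^sup>2 / 2))"
      using Suc.IH[of "\<lambda>t. g t * exp ((a n t)\<^sup>2 / 2)"] Suc.prems by auto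
    define s where "s t = (\<Sum>i<n. \<sigma> i * a i t)" for t
    \<comment> \<open>\<open>F e\<close> is the sum when the last sign is \<open>e\<close>. Since
      \<open>cosh (s + a) + cosh (s - a) = 2 * cosh s * cosh a\<close>, the mean of
      \<open>F 1\<close> and \<open>F (-1)\<close> obeys the bound, hence so does one of the
      two.\<close>
    define F where "F e = (\<Sum>t\<in>A. g t * cosh (s t + e * a n t))" for e :: real
    have "F 1 + F (-1) = (\<Sum>t\<in>A. 2 * (g t * cosh (a n t) * cosh (s t)))"
      by (simp add: F_def cosh_add cosh_diff algebra_simps flip: sum.distrib)
    also have "\<dots> \<le> (\<Sum>t\<in>A. 2 * (g t * exp ((a n t)\<^sup>2 / 2) * cosh (s t)))"
      by (intro sum_mono mult_left_mono mult_right_mono cosh_le_exp_power2_half)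
         (use Suc.prems cosh_real_nonneg in auto)
    also have "\<dots> = 2 * (\<Sum>t\<in>A. (g t * exp ((a n t)\<^sup>2 / 2)) * cosh (\<Sum>i<n. \<sigma> i * a i t))"
      by (simp only: s_def sum_distrib_left)
    also have "\<dots> \<le> 2 * (\<Sum>t\<in>A. (g t * exp ((a n t)\<^sup>2 / 2)) * exp (\<Sum>i<n. (a i t)\<^sup>2 / 2))"
      using \<sigma>(2) by simp
    also have "\<dots> = 2 * (\<Sum>t\<in>A. g t * exp (\<Sum>i<Suc n. (a i t)\<^sup>2 / 2))"
      by (simp only: sum.lessThan_Suc exp_add mult.assoc mult.commute[of "exp (\<Sum>i<n. _ i)"])
    finally have "F 1 \<le> (\<Sum>t\<in>A. g t * exp (\<Sum>i<Suc n. (a i t)\<^sup>2 / 2)) \<or>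
        F (-1) \<le> (\<Sum>t\<in>A. g t * exp (\<Sum>i<Suc n. (a i t)\<^sup>2 / 2))" by linarith
    then obtain e where e: "e = 1 \<or> e = - 1"
      "F e \<le> (\<Sum>t\<in>A. g t * exp (\<Sum>i<Suc n. (a i t)\<^sup>2 / 2))" by blast
    have "(\<Sum>i<n. (\<sigma>(n := e)) i * a i t) = s t" for t
      unfolding s_def by (rule sum.cong) auto
    then show ?case
      by (intro exI[of _ "\<sigma>(n := e)"]) (use \<sigma>(1) e in \<open>auto simp: F_def\<close>)
  qed

section \<open>The objective class\<close>

text \<open>The inequalities of the class with the gradient map as an explicit argument. That
  \<open>G\<close> is continuous and really is the gradient is derived from them below.\<close>

definition smooth_strongly_convex ::
  "nat \<Rightarrow> real \<Rightarrow> real \<Rightarrow> ((nat \<Rightarrow> real) \<Rightarrow> real) \<Rightarrow> ((nat \<Rightarrow> real) \<Rightarrow> nat \<Rightarrow> real) \<Rightarrow> bool" where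
  "smooth_strongly_convex d \<mu> \<beta> f G \<longleftrightarrow>
     (\<forall>x\<in>Rn d. G x \<in> Rn d) \<and>
     (\<forall>x\<in>Rn d. \<forall>y\<in>Rn d.
        f y \<ge> f x + inner_Rn d (G x) (y - x) + \<mu> / 2 * (norm_Rn d (y - x))\<^sup>2 \<and>
        norm_Rn d (G x - G y) \<le> \<beta> * norm_Rn d (x - y))"

lemma smooth_strongly_convex_lower:
  assumes "smooth_strongly_convex d \<mu> \<beta> f G" "x \<in> Rn d" "y \<in> Rn d"
  shows "f y \<ge> f x + inner_Rn d (G x) (y - x) + \<mu> / 2 * (norm_Rn d (y - x))\<^sup>2"
  using assms by (simp add: smooth_strongly_convex_def)

text \<open>The constant is \<open>\<beta>\<close> instead of the optimal \<open>\<beta> / 2\<close>, so that convexity at \<open>y\<close> suffices and no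
  integration is needed.\<close>

lemma smooth_strongly_convex_upper:
  assumes "smooth_strongly_convex d \<mu> \<beta> f G" "0 \<le> \<mu>" "x \<in> Rn d" "y \<in> Rn d"
  shows "f y \<le> f x + inner_Rn d (G x) (y - x) + \<beta> * (norm_Rn d (y - x))\<^sup>2"
proof -
  have "f x \<ge> f y + inner_Rn d (G y) (x - y) + \<mu> / 2 * (norm_Rn d (x - y))\<^sup>2"
    using assms by (intro smooth_strongly_convex_lower)
  then have "f y \<le> f x + inner_Rn d (G y) (y - x)"
    using mult_nonneg_nonneg[OF assms(2) zero_le_power2[of "norm_Rn d (x - y)"]]
    by (simp add: inner_Rn_simps)
  also have "\<dots> = f x + inner_Rn d (G x) (y - x) + inner_Rn d (G y - G x) (y - x)"
    by (simp add: inner_Rn_simps)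
  also have "inner_Rn d (G y - G x) (y - x) \<le> norm_Rn d (G y - G x) * norm_Rn d (y - x)"
    using inner_Rn_le_norm by (rule order_trans[OF abs_ge_self])
  also have "\<dots> \<le> (\<beta> * norm_Rn d (y - x)) * norm_Rn d (y - x)"
    by (intro mult_right_mono) (use assms in \<open>auto simp: smooth_strongly_convex_def\<close>)
  finally show ?thesis by (simp only: power2_eq_square mult.assoc)
qed

text \<open>Strong convexity at the midpoint \<open>m\<close>, towards \<open>x\<close> and towards
  \<open>z\<close>: the two gradient terms cancel, and \<open>f m\<close> is at least
  \<open>f z\<close>. The gradient at the minimiser is never evaluated; the price is \<mu>/4 in
  place of \<mu>/2.\<close>

lemma smooth_strongly_convex_growth:
  assumes f: "smooth_strongly_convex d \<mu> \<beta> f G" and x: "x \<in> Rn d" and z: "z \<in> Rn d"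
    and min: "\<And>y. y \<in> Rn d \<Longrightarrow> f z \<le> f y"
  shows "f x \<ge> f z + \<mu> / 4 * (norm_Rn d (x - z))\<^sup>2"
proof -
  define m where "m = (\<lambda>i. (1/2) * x i + (1/2) * z i)"
  define w where "w = (\<lambda>i. (1/2) * (x - z) i)"
  have m: "m \<in> Rn d" using x z by (simp add: m_def Rn_iff)
  have xm: "x - m = w" and zm: "z - m = (\<lambda>i. (-1) * w i)" by (auto simp: m_def w_def)
  have "f x \<ge> f m + inner_Rn d (G m) w + \<mu> / 2 * (norm_Rn d w)\<^sup>2"
    using smooth_strongly_convex_lower[OF f m x] by (simp only: xm)
  moreover have "f z \<ge> f m - inner_Rn d (G m) w + \<mu> / 2 * (norm_Rn d w)\<^sup>2"
    using smooth_strongly_convex_lower[OF f m z] by (simp only: zm norm_Rn_scale inner_Rn_simps) simp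
  moreover have "(norm_Rn d w)\<^sup>2 = (norm_Rn d (x - z))\<^sup>2 / 4"
    unfolding w_def norm_Rn_scale power_mult_distrib by (simp add: power2_eq_square fun_diff_def)
  ultimately have "f x + f z \<ge> 2 * f m + \<mu> / 4 * (norm_Rn d (x - z))\<^sup>2" by simp
  then show ?thesis using min[OF m] by simp
qed

section \<open>Continuity and differentiability from the two inequalities\<close>

lemma tendsto_norm_Rn_diff: "((\<lambda>x. norm_Rn d (x - z)) \<longlongrightarrow> 0) (at z within S)"
proof -
  have c: "continuous_on UNIV (\<lambda>x::nat\<Rightarrow>real. norm_Rn d (x - z))"
    unfolding norm_Rn_def L2_set_def minus_apply
    by (intro continuous_intros continuous_on_product_coordinates)
  have "((\<lambda>x. norm_Rn d (x - z)) \<longlongrightarrow> norm_Rn d (z - z)) (at z)"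
    using c by (metis UNIV_I continuous_on_def)
  then have "((\<lambda>x. norm_Rn d (x - z)) \<longlongrightarrow> 0) (at z)"
    by (simp add: norm_Rn_def L2_set_def)
  then show ?thesis by (rule tendsto_within_subset) auto
qed

lemma smooth_strongly_convex_continuous_gradient:
  assumes f: "smooth_strongly_convex d \<mu> \<beta> f G"
  shows "continuous_on (Rn d) G"
proof (rule continuous_on_coordinatewise_then_product)
  fix i
  show "continuous_on (Rn d) (\<lambda>x. G x i)"
  proof (cases "i < d")
    case False
    then have "G x i = 0" if "x \<in> Rn d" for x
      using f that by (simp add: smooth_strongly_convex_def Rn_iff)
    then show ?thesis by (simp cong: continuous_on_cong)
  next
    case True
    show ?thesis
      unfolding continuous_on_def
    proof
      fix z assume z: "z \<in> Rn d"
      have "((\<lambda>x. G x i - G z i) \<longlongrightarrow> 0) (at z within Rn d)"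
      proof (rule Lim_null_comparison)
        show "((\<lambda>x. \<beta> * norm_Rn d (x - z)) \<longlongrightarrow> 0) (at z within Rn d)"
          using tendsto_mult_left[OF tendsto_norm_Rn_diff] by simp
        show "\<forall>\<^sub>F x in at z within Rn d. norm (G x i - G z i) \<le> \<beta> * norm_Rn d (x - z)"
          unfolding eventually_at_filter
        proof (rule always_eventually, safe)
          fix x assume "x \<in> Rn d"
          then have "norm_Rn d (G x - G z) \<le> \<beta> * norm_Rn d (x - z)"
            using f z by (simp add: smooth_strongly_convex_def)
          then show "norm (G x i - G z i) \<le> \<beta> * norm_Rn d (x - z)"
            using abs_le_norm_Rn[OF True, of "G x - G z"] by simp
        qed
      qed
      then show "((\<lambda>x. G x i) \<longlongrightarrow> G z i) (at z within Rn d)" by (simp add: LIM_zero_iff)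
    qed
  qed
qed

lemma smooth_strongly_convex_error:
  assumes f: "smooth_strongly_convex d \<mu> \<beta> f G" and "0 \<le> \<mu>" "x \<in> Rn d" "y \<in> Rn d"
  shows "\<bar>f y - f x - inner_Rn d (G x) (y - x)\<bar> \<le> \<beta> * (norm_Rn d (y - x))\<^sup>2"
proof -
  have "0 \<le> \<mu> / 2 * (norm_Rn d (y - x))\<^sup>2" using assms(2) by simp
  then show ?thesis
    using smooth_strongly_convex_lower[OF f assms(3,4)] smooth_strongly_convex_upper[OF assms]
    by linarith
qed

lemma smooth_strongly_convex_has_gradient:
  assumes f: "smooth_strongly_convex d \<mu> \<beta> f G" and "0 \<le> \<mu>" "0 < \<beta>" "x \<in> Rn d"
  shows "has_gradient_Rn d f (G x) x"
  unfolding has_gradient_Rn_def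
proof (intro conjI allI impI)
  show "G x \<in> Rn d" using assms by (simp add: smooth_strongly_convex_def)
  fix e :: real assume "0 < e"
  show "\<exists>\<delta>>0. \<forall>y\<in>Rn d. norm_Rn d (y - x) < \<delta> \<longrightarrow>
        \<bar>f y - f x - inner_Rn d (G x) (y - x)\<bar> \<le> e * norm_Rn d (y - x)"
  proof (intro exI conjI ballI impI)
    show "0 < e / \<beta>" using \<open>0 < e\<close> \<open>0 < \<beta>\<close> by simp
    fix y assume "y \<in> Rn d" "norm_Rn d (y - x) < e / \<beta>"
    then have "\<beta> * norm_Rn d (y - x) \<le> e" using \<open>0 < \<beta>\<close> by (simp add: field_simps)
    then have "\<beta> * (norm_Rn d (y - x))\<^sup>2 \<le> e * norm_Rn d (y - x)"
      unfolding power2_eq_square mult.assoc[symmetric] by (rule mult_right_mono) simp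
    then show "\<bar>f y - f x - inner_Rn d (G x) (y - x)\<bar> \<le> e * norm_Rn d (y - x)"
      using smooth_strongly_convex_error[OF f assms(2,4) \<open>y \<in> Rn d\<close>] by linarith
  qed
qed

lemma smooth_strongly_convex_continuous:
  assumes f: "smooth_strongly_convex d \<mu> \<beta> f G" and "0 \<le> \<mu>"
  shows "continuous_on (Rn d) f"
  unfolding continuous_on_def
proof
  fix z assume z: "z \<in> Rn d"
  have "((\<lambda>x. f x - f z) \<longlongrightarrow> 0) (at z within Rn d)"
  proof (rule Lim_null_comparison)
    have "((\<lambda>x. norm_Rn d (G z) * norm_Rn d (x - z) + \<beta> * (norm_Rn d (x - z))\<^sup>2)
        \<longlongrightarrow> norm_Rn d (G z) * 0 + \<beta> * 0\<^sup>2) (at z within Rn d)"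
      by (intro tendsto_intros tendsto_norm_Rn_diff)
    then show "((\<lambda>x. norm_Rn d (G z) * norm_Rn d (x - z) + \<beta> * (norm_Rn d (x - z))\<^sup>2)
        \<longlongrightarrow> 0) (at z within Rn d)" by simp
    show "\<forall>\<^sub>F x in at z within Rn d. norm (f x - f z)
        \<le> norm_Rn d (G z) * norm_Rn d (x - z) + \<beta> * (norm_Rn d (x - z))\<^sup>2"
      unfolding eventually_at_filter
    proof (rule always_eventually, safe)
      fix x assume "x \<in> Rn d"
      then show "norm (f x - f z)
          \<le> norm_Rn d (G z) * norm_Rn d (x - z) + \<beta> * (norm_Rn d (x - z))\<^sup>2"
        using smooth_strongly_convex_error[OF f assms(2) z] inner_Rn_le_norm[of d "G z" "x - z"]
        by fastforce
    qed
  qed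
  then show "(f \<longlongrightarrow> f z) (at z within Rn d)" by (simp add: LIM_zero_iff)
qed

section \<open>Minimisers and membership in the class\<close>

lemma Euclidean_space_eq_top_of_set: "Euclidean_space d = top_of_set (Rn d)"
  by (simp add: Euclidean_space_def euclidean_product_topology)

text \<open>Coercivity confines the search to a compact box: outside it \<open>f\<close> is at least
  its value at the origin.\<close>

lemma exists_minimizer_Rn:
  assumes f: "continuous_on (Rn d) f" and "0 < c"
    and coercive: "\<And>x. x \<in> Rn d \<Longrightarrow> c * (norm_Rn d x)\<^sup>2 \<le> f x"
  shows "\<exists>z\<in>Rn d. \<forall>x\<in>Rn d. f z \<le> (f x :: real)"
proof -
  \<comment> \<open>Chosen so that c r^2 is the value of \<open>f\<close> at the origin.\<close>
  define r where "r = sqrt (f (\<lambda>_. 0) / c)"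
  \<comment> \<open>Coordinates from \<open>d\<close> on are pinned to 0, which makes
    \<open>K\<close> a product of compact sets in the full product space, compact by
    Tychonoff.\<close>
  define K where "K = PiE UNIV (\<lambda>i. if i < d then {-r..r} else {0::real})"
  have z0: "(\<lambda>_. 0) \<in> Rn d" by (simp add: Rn_iff)
  have f0: "0 \<le> f (\<lambda>_. 0)" using coercive[OF z0] \<open>0 < c\<close>
    by (simp add: norm_Rn_def L2_set_def)
  have r: "0 \<le> r" using f0 \<open>0 < c\<close> by (simp add: r_def)
  have KR: "K \<subseteq> Rn d"
    by (auto simp: K_def PiE_iff Rn_iff split: if_splits) (metis not_le singletonD)
  have "compactin (product_topology (\<lambda>i::nat. euclidean) UNIV) K"
    unfolding K_def compactin_PiE by auto
  then have "compact K" by (simp add: euclidean_product_topology)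
  moreover have "(\<lambda>_. 0) \<in> K" using r by (auto simp: K_def)
  ultimately obtain z where z: "z \<in> K" "\<forall>x\<in>K. f z \<le> f x"
    using continuous_attains_inf[of K f] continuous_on_subset[OF f KR] by blast
  have "f z \<le> f x" if x: "x \<in> Rn d" for x
  proof (cases "x \<in> K")
    case False
    have "x \<in> K" if "\<forall>i<d. \<bar>x i\<bar> \<le> r"
      unfolding K_def using x that by (auto simp: PiE_iff Rn_iff abs_le_iff minus_le_iff)
    with False obtain i where i: "i < d" "\<not> \<bar>x i\<bar> \<le> r" by blast
    have "r < norm_Rn d x" using i abs_le_norm_Rn[of i d x] by linarith
    then have "r\<^sup>2 < (norm_Rn d x)\<^sup>2" using r by (rule power_strict_mono) simp
    then have "f (\<lambda>_. 0) \<le> c * (norm_Rn d x)\<^sup>2"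
      using \<open>0 < c\<close> f0 by (simp add: r_def field_simps)
    then show ?thesis using coercive[OF x] z(2) \<open>(\<lambda>_. 0) \<in> K\<close> by force
  qed (use z in auto)
  then show ?thesis using z KR by blast
qed

text \<open>Quadratic growth makes the minimiser unique, and uniqueness identifies the choice
  \<open>arg_min_on\<close> with \<open>z\<close>.\<close>

lemma obj_classI:
  assumes f: "smooth_strongly_convex d \<mu> \<beta> f G" and "0 < \<mu>" "0 < \<beta>"
    and z: "z \<in> ball2 d (R / 2)" and min: "\<And>y. y \<in> Rn d \<Longrightarrow> f z \<le> f y"
  shows "f \<in> obj_class d R \<mu> \<beta>" and "min_value d f = f z"
proof -
  have zR: "z \<in> Rn d" using z by (simp add: ball2_def)
  have uniq: "y = z" if "is_arg_min f (\<lambda>x. x \<in> Rn d) y" for y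
  proof -
    have y: "y \<in> Rn d" "f y \<le> f z" using that zR by (auto simp: is_arg_min_linorder)
    then have "\<mu> / 4 * (norm_Rn d (y - z))\<^sup>2 \<le> 0"
      using smooth_strongly_convex_growth[OF f y(1) zR min] by linarith
    then have "norm_Rn d (y - z) = 0"
      using \<open>0 < \<mu>\<close> by (simp add: mult_le_0_iff)
    then show ?thesis using y(1) zR norm_Rn_eq_0D[of d "y - z"] by (intro Rn_eqI) auto
  qed
  have argmin: "is_arg_min f (\<lambda>x. x \<in> Rn d) z" using zR min by (simp add: is_arg_min_linorder)
  then have z_eq: "arg_min_on f (Rn d) = z"
    unfolding arg_min_on_def arg_min_def by (intro some_equality uniq)
  then show "min_value d f = f z" by (simp add: min_value_def)
  have "continuous_map (top_of_set (Rn d)) (top_of_set (Rn d)) G"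
    unfolding continuous_map_in_subtopology continuous_map_iff_continuous topspace_subtopology
    using smooth_strongly_convex_continuous_gradient[OF f] f
    unfolding smooth_strongly_convex_def by blast
  then have "continuous_map (Euclidean_space d) (Euclidean_space d) G"
    by (simp only: Euclidean_space_eq_top_of_set[symmetric])
  moreover have "\<exists>!x. is_arg_min f (\<lambda>x. x \<in> Rn d) x" using argmin uniq by blast
  ultimately show "f \<in> obj_class d R \<mu> \<beta>"
    unfolding obj_class_def mem_Collect_eq z_eq
  proof (intro conjI exI[of _ G])
    show "\<forall>x\<in>Rn d. has_gradient_Rn d f (G x) x"
      using smooth_strongly_convex_has_gradient[OF f] \<open>0 < \<mu>\<close> \<open>0 < \<beta>\<close> by simp
    show "\<forall>x\<in>Rn d. \<forall>y\<in>Rn d.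
        f y \<ge> f x + inner_Rn d (G x) (y - x) + \<mu> / 2 * (norm_Rn d (y - x))\<^sup>2 \<and>
        norm_Rn d (G x - G y) \<le> \<beta> * norm_Rn d (x - y)"
      using f unfolding smooth_strongly_convex_def by (rule conjunct2)
  qed (use z in auto)
qed

lemma obj_classE:
  assumes "f \<in> obj_class d R \<mu> \<beta>"
  obtains G z where "smooth_strongly_convex d \<mu> \<beta> f G" "z \<in> ball2 d (R / 2)"
    "\<And>y. y \<in> Rn d \<Longrightarrow> f z \<le> f y" "min_value d f = f z"
proof -
  let ?z = "arg_min_on f (Rn d)"
  from assms obtain G where G: "\<forall>x\<in>Rn d. has_gradient_Rn d f (G x) x"
    "\<forall>x\<in>Rn d. \<forall>y\<in>Rn d.
             f y \<ge> f x + inner_Rn d (G x) (y - x) + \<mu> / 2 * (norm_Rn d (y - x))\<^sup>2 \<and>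
             norm_Rn d (G x - G y) \<le> \<beta> * norm_Rn d (x - y)"
    "\<exists>!x. is_arg_min f (\<lambda>x. x \<in> Rn d) x" "?z \<in> ball2 d (R / 2)"
    unfolding obj_class_def by blast
  have "is_arg_min f (\<lambda>x. x \<in> Rn d) ?z"
    unfolding arg_min_on_def arg_min_def using G(3) by (metis someI_ex)
  moreover have "smooth_strongly_convex d \<mu> \<beta> f G"
    using G(1,2) by (simp add: smooth_strongly_convex_def has_gradient_Rn_def)
  ultimately show ?thesis
    using that[of G ?z] G(4) by (auto simp: is_arg_min_linorder min_value_def)
qed

text \<open>The frame bound says that the map sending \<open>x\<close> to its inner products with
  the \<open>u l\<close> has norm at most 2; so has its adjoint. With 1-Lipschitz \<phi>' in
  between, the ridge sum has a 4-Lipschitz gradient, and the quadratic term supplies the strong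
  convexity.\<close>

lemma ridge_smooth_strongly_convex:
  assumes conv: "\<And>l s t. \<phi> l t \<ge> \<phi> l s + \<phi>' l s * (t - s)"
    and lip: "\<And>l s t. \<bar>\<phi>' l t - \<phi>' l s\<bar> \<le> \<bar>t - s\<bar>"
    and u: "\<And>l. l < k \<Longrightarrow> u l \<in> Rn d"
    and frame: "\<And>x. (\<Sum>l<k. (inner_Rn d (u l) x)\<^sup>2) \<le> 4 * inner_Rn d x x"
    and p: "p \<in> Rn d" and B: "0 \<le> B" and \<mu>: "0 \<le> \<mu>" and \<beta>: "4 * B + \<mu> \<le> \<beta>"
  shows "smooth_strongly_convex d \<mu> \<beta>
    (\<lambda>x. B * (\<Sum>l<k. \<phi> l (inner_Rn d (u l) x)) + \<mu> / 2 * (norm_Rn d (x - p))\<^sup>2)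
    (\<lambda>x i. B * (\<Sum>l<k. \<phi>' l (inner_Rn d (u l) x) * u l i) + \<mu> * (x - p) i)"
    (is "smooth_strongly_convex d \<mu> \<beta> ?f ?G")
  unfolding smooth_strongly_convex_def
proof (intro conjI ballI)
  fix x assume x: "x \<in> Rn d"
  show "?G x \<in> Rn d" using u x p by (simp add: Rn_iff)
  fix y assume y: "y \<in> Rn d"
  have "inner_Rn d (?G x) (y - x)
      = B * (\<Sum>l<k. \<phi>' l (inner_Rn d (u l) x) * (inner_Rn d (u l) y - inner_Rn d (u l) x))
        + \<mu> * inner_Rn d (x - p) (y - x)"
    unfolding inner_Rn_add_left inner_Rn_scale_left inner_Rn_sum_left inner_Rn_diff_right ..
  moreover have "(norm_Rn d (y - p))\<^sup>2
      = (norm_Rn d (x - p))\<^sup>2 + 2 * inner_Rn d (x - p) (y - x) + (norm_Rn d (y - x))\<^sup>2"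
    unfolding norm_Rn_power2 inner_Rn_diff_left inner_Rn_diff_right
    by (simp add: inner_Rn_commute[of d p x] inner_Rn_commute[of d y x] inner_Rn_commute[of d p y])
  then have "\<mu> / 2 * (norm_Rn d (y - p))\<^sup>2 = \<mu> / 2 * (norm_Rn d (x - p))\<^sup>2
      + \<mu> * inner_Rn d (x - p) (y - x) + \<mu> / 2 * (norm_Rn d (y - x))\<^sup>2"
    by (simp add: algebra_simps)
  moreover have "B * (\<Sum>l<k. \<phi> l (inner_Rn d (u l) x))
      + B * (\<Sum>l<k. \<phi>' l (inner_Rn d (u l) x) * (inner_Rn d (u l) y - inner_Rn d (u l) x))
      \<le> B * (\<Sum>l<k. \<phi> l (inner_Rn d (u l) y))"
    unfolding distrib_left[symmetric] sum.distrib[symmetric]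
    by (intro mult_left_mono sum_mono conv B)
  ultimately show "?f x + inner_Rn d (?G x) (y - x) + \<mu> / 2 * (norm_Rn d (y - x))\<^sup>2 \<le> ?f y"
    by linarith
  define c where "c l = \<phi>' l (inner_Rn d (u l) x) - \<phi>' l (inner_Rn d (u l) y)" for l
  define w where "w = (\<lambda>i. \<Sum>l<k. c l * u l i)"
  \<comment> \<open>The adjoint bound by duality: Cauchy-Schwarz and the frame bound for
    \<open>w\<close> leave one factor of the norm of \<open>w\<close> to cancel, unless that norm is
    0.\<close>
  have "inner_Rn d w w = (\<Sum>l<k. c l * inner_Rn d (u l) w)"
    by (subst (1) w_def) (simp add: inner_Rn_sum_left inner_Rn_scale_left)
  also have "\<dots> \<le> (\<Sum>l<k. \<bar>c l\<bar> * \<bar>inner_Rn d (u l) w\<bar>)"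
    by (rule sum_mono) (metis abs_ge_self abs_mult)
  also have "\<dots> \<le> sqrt (\<Sum>l<k. (c l)\<^sup>2) * sqrt (\<Sum>l<k. (inner_Rn d (u l) w)\<^sup>2)"
    using L2_set_mult_ineq unfolding L2_set_def .
  also have "\<dots> \<le> sqrt (4 * inner_Rn d (x - y) (x - y)) * sqrt (4 * inner_Rn d w w)"
  proof (intro mult_mono real_sqrt_le_mono)
    have "(\<Sum>l<k. (c l)\<^sup>2) \<le> (\<Sum>l<k. (inner_Rn d (u l) (x - y))\<^sup>2)"
      unfolding c_def inner_Rn_diff_right by (intro sum_mono abs_le_square_iff[THEN iffD1] lip)
    also have "\<dots> \<le> 4 * inner_Rn d (x - y) (x - y)" by (rule frame)
    finally show "(\<Sum>l<k. (c l)\<^sup>2) \<le> 4 * inner_Rn d (x - y) (x - y)" .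
  qed (auto intro: frame sum_nonneg)
  also have "\<dots> = 4 * norm_Rn d (x - y) * norm_Rn d w"
    by (simp add: real_sqrt_mult flip: norm_Rn_power2)
  finally have "norm_Rn d w * norm_Rn d w \<le> 4 * norm_Rn d (x - y) * norm_Rn d w"
    by (simp only: norm_Rn_power2[symmetric] power2_eq_square)
  then have w: "norm_Rn d w \<le> 4 * norm_Rn d (x - y)"
    by (cases "norm_Rn d w = 0") (auto simp: less_le)
  have "?G x - ?G y = (\<lambda>i. B * w i + \<mu> * (x - y) i)"
    by (rule ext) (simp add: w_def c_def sum_subtractf algebra_simps)
  then have "norm_Rn d (?G x - ?G y) \<le> B * norm_Rn d w + \<mu> * norm_Rn d (x - y)"
    using norm_Rn_add[of d "\<lambda>i. B * w i" "\<lambda>i. \<mu> * (x - y) i"] B \<mu>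
    by (simp only: norm_Rn_scale abs_of_nonneg)
  also have "\<dots> \<le> B * (4 * norm_Rn d (x - y)) + \<mu> * norm_Rn d (x - y)"
    using w B by (intro add_right_mono mult_left_mono) auto
  also have "\<dots> = (4 * B + \<mu>) * norm_Rn d (x - y)" by (simp add: algebra_simps)
  also have "\<dots> \<le> \<beta> * norm_Rn d (x - y)" using \<beta> by (rule mult_right_mono) simp
  finally show "norm_Rn d (?G x - ?G y) \<le> \<beta> * norm_Rn d (x - y)" .
qed

section \<open>Chains with a dead zone\<close>

text \<open>Soft thresholding: for \<delta> \<ge> 0 it is \<open>t\<close> minus the projection of
  \<open>t\<close> onto [-\<delta>, \<delta>], that is, the derivative of half the squared distance
  to this interval.\<close>

definition dead_zone :: "real \<Rightarrow> real \<Rightarrow> real" where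
  "dead_zone \<delta> t = max 0 (t - \<delta>) + min 0 (t + \<delta>)"

lemma dead_zone_eq_0: "\<bar>t\<bar> \<le> \<delta> \<Longrightarrow> dead_zone \<delta> t = 0"
  by (auto simp: dead_zone_def)

lemma abs_le_dead_zone: "0 \<le> \<delta> \<Longrightarrow> \<bar>t\<bar> \<le> \<delta> + \<bar>dead_zone \<delta> t\<bar>"
  by (auto simp: dead_zone_def max_def min_def)

lemma dead_zone_lipschitz: "0 \<le> \<delta> \<Longrightarrow> \<bar>dead_zone \<delta> t - dead_zone \<delta> s\<bar> \<le> \<bar>t - s\<bar>"
  by (auto simp: dead_zone_def max_def min_def)

lemma dead_zone_convex:
  assumes "0 \<le> \<delta>"
  shows "(dead_zone \<delta> t)\<^sup>2 / 2 \<ge> (dead_zone \<delta> s)\<^sup>2 / 2 + dead_zone \<delta> s * (t - s)"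
proof -
  let ?p = "dead_zone \<delta> s" and ?q = "dead_zone \<delta> t"
  \<comment> \<open>If \<open>?p\<close> is positive, then \<open>s - ?p\<close> equals \<delta>
    while \<open>t - ?q\<close> is at most \<delta>; symmetrically if it is negative.\<close>
  have *: "0 \<le> ?p * ((?q - ?p) - (t - s))"
    using assms unfolding zero_le_mult_iff
    by (auto simp: dead_zone_def max_def min_def)
  have "?q\<^sup>2 / 2 - ?p\<^sup>2 / 2 - ?p * (t - s) = (?q - ?p)\<^sup>2 / 2 + ?p * ((?q - ?p) - (t - s))"
    by (simp add: power2_eq_square algebra_simps diff_divide_distrib add_divide_distrib)
  then show ?thesis using * zero_le_power2[of "?q - ?p"] by linarith
qed

text \<open>The first \<open>i\<close> of the directions \<open>v 0, \<dots>, v K\<close> are in use; the coordinates along the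
  remaining ones are read as \<open>0\<close>.\<close>

definition chain_coord where
  "chain_coord d i v x l = (if l < i then inner_Rn d (v l) x else 0)"

text \<open>The first term pulls coordinate 0 towards \<open>a\<close>, and each link pulls its two
  coordinates to within \<delta> of each other. No term ties coordinate \<open>K\<close> to 0, so
  with all directions in use only the \<mu>-term resists having every coordinate equal to
  \<open>a\<close>.\<close>

definition chain ::
  "nat \<Rightarrow> real \<Rightarrow> real \<Rightarrow> real \<Rightarrow> real \<Rightarrow> nat \<Rightarrow> nat \<Rightarrow> (nat \<Rightarrow> nat \<Rightarrow> real) \<Rightarrow> (nat \<Rightarrow> real) \<Rightarrow> real"
  where
  "chain d \<mu> B a \<delta> K i v x =
     B * ((chain_coord d i v x 0 - a)\<^sup>2 / 2
       + (\<Sum>l<K. (dead_zone \<delta> (chain_coord d i v x l - chain_coord d i v x (Suc l)))\<^sup>2 / 2))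
     + \<mu> / 2 * (norm_Rn d x)\<^sup>2"

text \<open>Activating coordinate \<open>i\<close> affects only the links to its two neighbours. If
  coordinates \<open>i - 1\<close> and \<open>i\<close> are at most \<delta>/2, both links lie in
  the dead zone before and after. The anchor at coordinate 0 has no dead zone, hence
  \<open>0 < i\<close>.\<close>

lemma chain_Suc_eq:
  assumes "inner_Rn d (v i) x = 0 \<or>
    0 < i \<and> \<bar>inner_Rn d (v (i - 1)) x\<bar> \<le> \<delta> / 2 \<and> \<bar>inner_Rn d (v i) x\<bar> \<le> \<delta> / 2"
  shows "chain d \<mu> B a \<delta> K (Suc i) v x = chain d \<mu> B a \<delta> K i v x"
  using assms
proof
  assume "inner_Rn d (v i) x = 0"
  then have "chain_coord d (Suc i) v x = chain_coord d i v x"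
    by (auto simp: chain_coord_def less_Suc_eq)
  then show ?thesis by (simp add: chain_def)
next
  assume i: "0 < i \<and> \<bar>inner_Rn d (v (i - 1)) x\<bar> \<le> \<delta> / 2 \<and> \<bar>inner_Rn d (v i) x\<bar> \<le> \<delta> / 2"
  let ?c = "chain_coord d i v x" and ?c' = "chain_coord d (Suc i) v x"
  have "?c' 0 = ?c 0" using i by (auto simp: chain_coord_def)
  moreover have "dead_zone \<delta> (?c' l - ?c' (Suc l)) = dead_zone \<delta> (?c l - ?c (Suc l))" for l
  proof -
    consider "Suc l < i" | "Suc l = i" | "l = i" | "l > i" by linarith
    then show ?thesis
      by cases (use i in \<open>auto simp: chain_coord_def dead_zone_eq_0\<close>)
  qed
  ultimately show ?thesis by (simp add: chain_def)
qed

text \<open>The directions that exhibit the chain as a ridge sum; index \<open>Suc l'\<close> is the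
  link from \<open>l'\<close> to \<open>Suc l'\<close>.\<close>

definition chain_direction :: "(nat \<Rightarrow> nat \<Rightarrow> real) \<Rightarrow> nat \<Rightarrow> nat \<Rightarrow> real" where
  "chain_direction v l = (case l of 0 \<Rightarrow> v 0 | Suc l' \<Rightarrow> v l' - v (Suc l'))"

text \<open>(p - q)^2 \<le> 2 p^2 + 2 q^2, and each coordinate occurs in at most two links, or in
  the anchor and one link, so its square is counted at most four times; then Bessel.\<close>

lemma chain_direction_frame:
  assumes v: "orthonormal_Rn d (Suc K) v"
  shows "(\<Sum>l<Suc K. (inner_Rn d (chain_direction v l) x)\<^sup>2) \<le> 4 * inner_Rn d x x"
proof -
  let ?c = "\<lambda>l. (inner_Rn d (v l) x)\<^sup>2"
  have "(inner_Rn d (chain_direction v (Suc l)) x)\<^sup>2 \<le> 2 * ?c l + 2 * ?c (Suc l)" for l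
    using sum_squares_bound[of "inner_Rn d (v l) x" "- inner_Rn d (v (Suc l)) x"]
    by (simp add: chain_direction_def inner_Rn_simps power2_diff)
  then have "(\<Sum>l<K. (inner_Rn d (chain_direction v (Suc l)) x)\<^sup>2)
      \<le> (\<Sum>l<K. 2 * ?c l + 2 * ?c (Suc l))" by (intro sum_mono)
  then have "(\<Sum>l<Suc K. (inner_Rn d (chain_direction v l) x)\<^sup>2)
      \<le> ?c 0 + (2 * (\<Sum>l<K. ?c l) + 2 * (\<Sum>l<K. ?c (Suc l)))"
    unfolding sum.lessThan_Suc_shift
    by (simp add: chain_direction_def sum.distrib sum_distrib_left)
  also have "\<dots> \<le> 4 * (\<Sum>l<Suc K. ?c l)"
    using sum.lessThan_Suc_shift[of ?c K] sum.lessThan_Suc[of ?c K]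
      zero_le_power2[of "inner_Rn d (v 0) x"] zero_le_power2[of "inner_Rn d (v K) x"]
    by linarith
  also have "\<dots> \<le> 4 * inner_Rn d x x" using bessel_Rn[OF v] by (intro mult_left_mono) auto
  finally show ?thesis .
qed

lemma chain_smooth_strongly_convex:
  assumes v: "orthonormal_Rn d (Suc K) v"
    and "0 \<le> B" "0 \<le> \<mu>" "4 * B + \<mu> \<le> \<beta>" "0 \<le> \<delta>"
  shows "\<exists>G. smooth_strongly_convex d \<mu> \<beta> (chain d \<mu> B a \<delta> K (Suc K) v) G"
proof -
  define \<phi> where "\<phi> l t = (case l of 0 \<Rightarrow> (t - a)\<^sup>2 / 2 | Suc _ \<Rightarrow> (dead_zone \<delta> t)\<^sup>2 / 2)"
    for l :: nat and t
  define \<phi>' where "\<phi>' l t = (case l of 0 \<Rightarrow> t - a | Suc _ \<Rightarrow> dead_zone \<delta> t)" for l :: nat and t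
  have "smooth_strongly_convex d \<mu> \<beta>
      (\<lambda>x. B * (\<Sum>l<Suc K. \<phi> l (inner_Rn d (chain_direction v l) x))
        + \<mu> / 2 * (norm_Rn d (x - (\<lambda>_. 0)))\<^sup>2)
      (\<lambda>x i. B * (\<Sum>l<Suc K. \<phi>' l (inner_Rn d (chain_direction v l) x) * chain_direction v l i)
        + \<mu> * (x - (\<lambda>_. 0)) i)"
  proof (rule ridge_smooth_strongly_convex)
    fix l :: nat and s t :: real
    have "(t - a)\<^sup>2 / 2 = (s - a)\<^sup>2 / 2 + (s - a) * (t - s) + (t - s)\<^sup>2 / 2"
      by (simp add: power2_eq_square algebra_simps diff_divide_distrib add_divide_distrib)
    then have "(s - a)\<^sup>2 / 2 + (s - a) * (t - s) \<le> (t - a)\<^sup>2 / 2"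
      using zero_le_power2[of "t - s"] by linarith
    then show "\<phi> l s + \<phi>' l s * (t - s) \<le> \<phi> l t"
      using dead_zone_convex[OF \<open>0 \<le> \<delta>\<close>] by (auto simp: \<phi>_def \<phi>'_def split: nat.split)
    show "\<bar>\<phi>' l t - \<phi>' l s\<bar> \<le> \<bar>t - s\<bar>"
      using dead_zone_lipschitz[OF \<open>0 \<le> \<delta>\<close>] by (auto simp: \<phi>'_def split: nat.split)
  next
    fix l assume "l < Suc K"
    then show "chain_direction v l \<in> Rn d"
      using v by (auto simp: chain_direction_def orthonormal_Rn_def Rn_iff split: nat.split)
  qed (use assms chain_direction_frame[OF v] in \<open>auto simp: Rn_iff\<close>)
  moreover have "B * (\<Sum>l<Suc K. \<phi> l (inner_Rn d (chain_direction v l) x))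
        + \<mu> / 2 * (norm_Rn d (x - (\<lambda>_. 0)))\<^sup>2 = chain d \<mu> B a \<delta> K (Suc K) v x" for x
    unfolding sum.lessThan_Suc_shift
    by (simp add: chain_def \<phi>_def chain_direction_def chain_coord_def fun_diff_def
        inner_Rn_diff_left[unfolded fun_diff_def])
  ultimately show ?thesis by (auto simp: fun_eq_iff)
qed

text \<open>Comparison with \<open>a (v 0 + \<dots> + v K)\<close> shows that all coordinates of a minimiser along the
  chain are comparable to \<open>a\<close>.\<close>

lemma chain_minimizer:
  assumes v: "orthonormal_Rn d (Suc K) v"
    and B: "0 < B" and \<mu>: "0 < \<mu>" and \<delta>: "0 \<le> \<delta>" and a: "0 < a"
    and short: "16 * \<mu> * (real (Suc K))\<^sup>2 \<le> B" and narrow: "4 * real (Suc K) * \<delta> \<le> a"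
    and min: "\<And>y. y \<in> Rn d \<Longrightarrow> chain d \<mu> B a \<delta> K (Suc K) v z \<le> chain d \<mu> B a \<delta> K (Suc K) v y"
  shows "(norm_Rn d z)\<^sup>2 \<le> real (Suc K) * a\<^sup>2"
    and "l \<le> K \<Longrightarrow> a / 2 \<le> inner_Rn d (v l) z"
proof -
  let ?k = "real (Suc K)"
  let ?f = "chain d \<mu> B a \<delta> K (Suc K) v"
  define y where "y r = (\<Sum>l<Suc K. a * v l r)" for r
  define c where "c l = inner_Rn d (v l) z" for l
  \<comment> \<open>Residuals of the anchor (index 0) and of the links.\<close>
  define \<rho> where "\<rho> l = (case l of 0 \<Rightarrow> c 0 - a | Suc l' \<Rightarrow> dead_zone \<delta> (c l' - c (Suc l')))" for l
  have yR: "y \<in> Rn d" using v by (auto simp: y_def Rn_iff orthonormal_Rn_def)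
  have vy: "inner_Rn d (v l) y = a" if "l < Suc K" for l
    unfolding y_def by (rule inner_Rn_orthonormal_sum[OF v that])
  have "inner_Rn d y y = (\<Sum>l<Suc K. a * inner_Rn d (v l) y)"
    by (subst (1) y_def[abs_def]) (simp only: inner_Rn_sum_left inner_Rn_scale_left)
  also have "\<dots> = ?k * a\<^sup>2" by (simp add: vy power2_eq_square)
  finally have "inner_Rn d y y = ?k * a\<^sup>2" .
  then have "?f y = \<mu> / 2 * (?k * a\<^sup>2)"
    by (simp add: chain_def chain_coord_def vy dead_zone_eq_0 \<delta> norm_Rn_power2)
  then have fz: "?f z \<le> \<mu> / 2 * (?k * a\<^sup>2)" using min[OF yR] by simp
  have "(\<Sum>l<Suc K. (\<rho> l)\<^sup>2) = (c 0 - a)\<^sup>2 + (\<Sum>l<K. (dead_zone \<delta> (c l - c (Suc l)))\<^sup>2)"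
    unfolding sum.lessThan_Suc_shift by (simp add: \<rho>_def)
  then have f: "?f z = B / 2 * (\<Sum>l<Suc K. (\<rho> l)\<^sup>2) + \<mu> / 2 * (norm_Rn d z)\<^sup>2"
    by (simp add: chain_def chain_coord_def c_def sum_divide_distrib[symmetric] algebra_simps)
  have nn: "0 \<le> B / 2 * (\<Sum>l<Suc K. (\<rho> l)\<^sup>2)" using B by (intro mult_nonneg_nonneg sum_nonneg) auto
  then have "\<mu> / 2 * (norm_Rn d z)\<^sup>2 \<le> \<mu> / 2 * (?k * a\<^sup>2)" using fz f by linarith
  then show "(norm_Rn d z)\<^sup>2 \<le> ?k * a\<^sup>2" using \<mu> by simp
  have "0 \<le> \<mu> / 2 * (norm_Rn d z)\<^sup>2" using \<mu> by simp
  then have "B * (\<Sum>l<Suc K. (\<rho> l)\<^sup>2) \<le> \<mu> * (?k * a\<^sup>2)" using fz f by linarith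
  \<comment> \<open>The stiffness \<open>B\<close> is large enough against the chain length to bound
    the residuals in l2; Cauchy-Schwarz turns this into an l1 bound of \<open>a / 4\<close>.\<close>
  then have "(16 * \<mu> * ?k\<^sup>2) * (\<Sum>l<Suc K. (\<rho> l)\<^sup>2) \<le> \<mu> * (?k * a\<^sup>2)"
    using mult_right_mono[OF short sum_nonneg[of "{..<Suc K}" "\<lambda>l. (\<rho> l)\<^sup>2"]] by simp
  then have "\<mu> * ?k * (16 * (?k * (\<Sum>l<Suc K. (\<rho> l)\<^sup>2))) \<le> \<mu> * ?k * a\<^sup>2"
    by (simp only: power2_eq_square mult_ac)
  then have "16 * (?k * (\<Sum>l<Suc K. (\<rho> l)\<^sup>2)) \<le> a\<^sup>2" using \<mu> by simp
  moreover have "(\<Sum>l<Suc K. \<bar>\<rho> l\<bar>)\<^sup>2 \<le> ?k * (\<Sum>l<Suc K. (\<rho> l)\<^sup>2)"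
    using sum_squared_le_sum_of_squares[of "\<lambda>l. \<bar>\<rho> l\<bar>" "{..<Suc K}"]
    unfolding power2_abs card_lessThan by (simp only: mult.commute)
  ultimately have "(4 * (\<Sum>l<Suc K. \<bar>\<rho> l\<bar>))\<^sup>2 \<le> a\<^sup>2" by (simp add: power_mult_distrib del: sum.lessThan_Suc)
  then have S: "4 * (\<Sum>l<Suc K. \<bar>\<rho> l\<bar>) \<le> a"
    by (rule power2_le_imp_le) (use a in simp)
  \<comment> \<open>Walking from the anchor to coordinate \<open>l\<close>, each link loses at most
    \<delta> plus its residual. Over the whole chain the dead zones lose at most
    \<open>a / 4\<close>, and so do the residuals.\<close>
  have telescope: "a - c l \<le> (\<Sum>j<Suc l. \<delta> + \<bar>\<rho> j\<bar>)" for l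
  proof (induction l)
    case 0
    then show ?case using \<delta> by (simp add: \<rho>_def)
  next
    case (Suc l)
    have "c l - c (Suc l) \<le> \<delta> + \<bar>\<rho> (Suc l)\<bar>"
      using abs_le_dead_zone[OF \<delta>, of "c l - c (Suc l)"] by (simp add: \<rho>_def)
    with Suc show ?case by simp
  qed
  assume "l \<le> K"
  then have "(\<Sum>j<Suc l. \<delta> + \<bar>\<rho> j\<bar>) \<le> (\<Sum>j<Suc K. \<delta> + \<bar>\<rho> j\<bar>)"
    using \<delta> by (intro sum_mono2) auto
  moreover have "(\<Sum>j<Suc K. \<delta> + \<bar>\<rho> j\<bar>) = ?k * \<delta> + (\<Sum>j<Suc K. \<bar>\<rho> j\<bar>)"
    by (simp only: sum.distrib sum_constant card_lessThan)
  ultimately have "a - c l \<le> ?k * \<delta> + (\<Sum>j<Suc K. \<bar>\<rho> j\<bar>)" using telescope[of l] by linarith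
  then show "a / 2 \<le> inner_Rn d (v l) z" using S narrow unfolding c_def by linarith
qed

text \<open>A normalised signed sum of \<open>n\<close> orthonormal vectors in the complement of
  \<open>S\<close>. The signs come from the derandomised Hoeffding bound, and the condition on
  \<open>card P\<close> is the union bound over \<open>P\<close>.\<close>

lemma exists_nearly_orthogonal_unit:
  assumes "finite S" "card S + n \<le> d" "finite P" "0 < R" "0 < n"
    and P: "\<And>x. x \<in> P \<Longrightarrow> norm_Rn d x \<le> R"
    and card: "2 * real (card P) < exp (real n * \<theta>\<^sup>2 / (2 * R\<^sup>2))" and "0 \<le> \<theta>"
  shows "\<exists>v\<in>Rn d. inner_Rn d v v = 1 \<and> (\<forall>s\<in>S. inner_Rn d v s = 0) \<and>
    (\<forall>x\<in>P. \<bar>inner_Rn d v x\<bar> \<le> \<theta>)"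
proof -
  obtain w where w: "orthonormal_Rn d n w" "\<forall>i<n. \<forall>s\<in>S. inner_Rn d (w i) s = 0"
    using exists_orthonormal_in_complement[OF assms(1,2)] by blast
  define c where "c = sqrt (real n)"
  have c: "0 < c" "c\<^sup>2 = real n" using \<open>0 < n\<close> by (auto simp: c_def)
  \<comment> \<open>The Chernoff parameter: it minimises
    \<open>lam\<^sup>2 * R\<^sup>2 / 2 - lam * c * \<theta>\<close>.\<close>
  define lam where "lam = \<theta> * c / R\<^sup>2"
  obtain \<sigma> :: "nat \<Rightarrow> real" where \<sigma>: "\<forall>i. \<sigma> i = 1 \<or> \<sigma> i = - 1"
    "(\<Sum>x\<in>P. 1 * cosh (\<Sum>i<n. \<sigma> i * (lam * inner_Rn d (w i) x)))
      \<le> (\<Sum>x\<in>P. 1 * exp (\<Sum>i<n. (lam * inner_Rn d (w i) x)\<^sup>2 / 2))"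
    using exists_signs_cosh_sum_le[where g = "\<lambda>_. 1" and n = n and A = P
        and a = "\<lambda>i x. lam * inner_Rn d (w i) x"] by auto
  define v where "v = (\<lambda>r. \<Sum>i<n. (\<sigma> i / c) * w i r)"
  have vin: "inner_Rn d v x = (\<Sum>i<n. \<sigma> i / c * inner_Rn d (w i) x)" for x
    by (simp only: v_def inner_Rn_sum_left inner_Rn_scale_left)
  have "inner_Rn d v v = (\<Sum>i<n. \<sigma> i / c * (\<sigma> i / c))"
    unfolding vin
    by (rule sum.cong) (simp_all only: v_def inner_Rn_orthonormal_sum[OF w(1)] lessThan_iff)
  also have "\<dots> = (\<Sum>i<n. 1 / real n)"
  proof (rule sum.cong)
    fix i
    have "\<sigma> i * \<sigma> i = 1" using \<sigma>(1)[rule_format, of i] by auto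
    then show "\<sigma> i / c * (\<sigma> i / c) = 1 / real n"
      by (simp add: c(2)[symmetric] power2_eq_square)
  qed simp
  finally have vv: "inner_Rn d v v = 1" using \<open>0 < n\<close> by simp
  have small: "\<bar>inner_Rn d v y\<bar> \<le> \<theta>" if "y \<in> P" for y
  proof (rule ccontr)
    assume "\<not> ?thesis"
    then have big: "\<theta> < \<bar>inner_Rn d v y\<bar>" by simp
    have s: "(\<Sum>i<n. \<sigma> i * (lam * inner_Rn d (w i) x)) = lam * c * inner_Rn d v x" for x
      using c by (simp add: vin sum_distrib_left algebra_simps)
    have lam: "0 \<le> lam" using \<open>0 \<le> \<theta>\<close> c by (simp add: lam_def)
    \<comment> \<open>With this \<open>lam\<close>, each point contributes at most \<open>?E\<close>
      to the sum of exponentials, whereas a violation at \<open>y\<close> alone would contribute at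
      least \<open>?E * ?E / 2\<close>.\<close>
    let ?E = "exp (real n * \<theta>\<^sup>2 / (2 * R\<^sup>2))"
    have "?E * ?E = exp (lam * c * \<theta>)"
      by (simp add: lam_def c(2)[symmetric] power2_eq_square flip: exp_add)
    also have "\<dots> \<le> exp (lam * c * \<bar>inner_Rn d v y\<bar>)"
      using lam c big by (intro exp_le_cancel_iff[THEN iffD2] mult_left_mono) auto
    also have "\<dots> = exp \<bar>lam * c * inner_Rn d v y\<bar>"
      using lam c by (simp add: abs_mult)
    also have "\<dots> \<le> 2 * cosh \<bar>lam * c * inner_Rn d v y\<bar>" by (simp add: cosh_def)
    also have "\<dots> = 2 * cosh (lam * c * inner_Rn d v y)" by (simp add: cosh_real_abs)
    also have "cosh (lam * c * inner_Rn d v y) \<le> (\<Sum>x\<in>P. cosh (lam * c * inner_Rn d v x))"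
      using that \<open>finite P\<close> by (intro member_le_sum) (auto intro: less_imp_le cosh_real_pos)
    also have "\<dots> \<le> (\<Sum>x\<in>P. exp (\<Sum>i<n. (lam * inner_Rn d (w i) x)\<^sup>2 / 2))"
      using \<sigma>(2) by (simp only: s mult_1)
    also have "\<dots> \<le> (\<Sum>x\<in>P. ?E)"
    proof (rule sum_mono, rule exp_le_cancel_iff[THEN iffD2])
      fix x assume "x \<in> P"
      then have "inner_Rn d x x \<le> R\<^sup>2" using P \<open>0 < R\<close> by (simp add: norm_Rn_le_iff[symmetric])
      then have "(\<Sum>i<n. (inner_Rn d (w i) x)\<^sup>2) \<le> R\<^sup>2"
        using bessel_Rn[OF w(1), of x] by linarith
      then have "lam\<^sup>2 / 2 * (\<Sum>i<n. (inner_Rn d (w i) x)\<^sup>2) \<le> lam\<^sup>2 / 2 * R\<^sup>2"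
        by (intro mult_left_mono) auto
      also have "\<dots> = real n * \<theta>\<^sup>2 / (2 * R\<^sup>2)"
        using \<open>0 < R\<close> by (simp add: lam_def c(2)[symmetric] power2_eq_square field_simps)
      finally show "(\<Sum>i<n. (lam * inner_Rn d (w i) x)\<^sup>2 / 2) \<le> real n * \<theta>\<^sup>2 / (2 * R\<^sup>2)"
        by (simp add: sum_distrib_left power_mult_distrib)
    qed
    finally have "?E * ?E \<le> (2 * real (card P)) * ?E" by simp
    then have "?E \<le> 2 * real (card P)" by simp
    with card show False by simp
  qed
  show ?thesis
  proof (intro bexI[of _ v] conjI ballI)
    show "v \<in> Rn d" using w(1) by (simp add: v_def Rn_iff orthonormal_Rn_def)
    show "inner_Rn d v s = 0" if "s \<in> S" for s using w(2) that by (simp add: vin)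
  qed (use vv small in auto)
qed

section \<open>The resisting oracle\<close>

lemma space_query_space: "space (query_space d R) = ball2 d R"
  by (simp add: query_space_def space_restrict_space)

lemma run_in_transcript_space:
  assumes "\<forall>t<T. Q t \<in> transcript_space d R t \<rightarrow>\<^sub>M query_space d R"
  shows "t \<le> T \<Longrightarrow> run Q f t \<in> space (transcript_space d R t)"
proof (induction t)
  case 0
  show ?case by (simp add: transcript_space_def space_PiM PiE_def extensional_def)
next
  case (Suc t)
  then have h: "run Q f t \<in> space (transcript_space d R t)" by simp
  have "Q t (run Q f t) \<in> ball2 d R"
    using measurable_space[OF _ h, of "Q t" "query_space d R"] assms Suc.prems
    by (simp add: space_query_space)
  then show ?case
    using h by (auto simp: transcript_space_def space_PiM space_pair_measure space_query_space
        PiE_iff Let_def extensional_def less_Suc_eq)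
qed

lemma query_in_ball2:
  assumes "algorithm d R T Q Qout" "t < T"
  shows "Q t (run Q f t) \<in> ball2 d R"
proof -
  have Q: "\<forall>t<T. Q t \<in> transcript_space d R t \<rightarrow>\<^sub>M query_space d R"
    using assms(1) by (simp add: algorithm_def)
  show ?thesis
    using measurable_space[OF Q[rule_format, OF assms(2)]
        run_in_transcript_space[OF Q less_imp_le[OF assms(2)]]]
    by (simp only: space_query_space)
qed

lemma output_in_ball2:
  assumes "algorithm d R T Q Qout"
  shows "Qout (run Q f T) \<in> ball2 d R"
proof -
  have Q: "\<forall>t<T. Q t \<in> transcript_space d R t \<rightarrow>\<^sub>M query_space d R"
    and out: "Qout \<in> transcript_space d R T \<rightarrow>\<^sub>M query_space d R"
    using assms by (simp_all add: algorithm_def)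
  show ?thesis
    using measurable_space[OF out run_in_transcript_space[OF Q order_refl]]
    by (simp only: space_query_space)
qed

text \<open>Indistinguishability: a deterministic algorithm sees the objective only at its queries.
  Agreement along the run on \<open>f\<close> suffices, because the run on \<open>g\<close> has not
  diverged before each of these queries.\<close>

lemma run_cong:
  assumes "\<And>s. s < t \<Longrightarrow> g (Q s (run Q f s)) = f (Q s (run Q f s))"
  shows "run Q g t = run Q f t"
  using assms by (induction t) (simp_all add: Let_def)

text \<open>The queries are cut into blocks of length \<open>m\<close>. Direction \<open>i\<close> is fixed after block \<open>i\<close>: it is
  orthogonal to the queries of that block and almost orthogonal to all earlier ones, so that
  inside the dead zone none of the answers given so far changes.\<close>

lemma resisting_chain:
  assumes alg: "algorithm d R T Q Qout" and T: "T \<le> J * m" and "0 \<le> \<delta>"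
    and hidden: "\<And>S P. finite S \<Longrightarrow> card S \<le> K + m + 1 \<Longrightarrow> finite P \<Longrightarrow> card P \<le> T \<Longrightarrow>
        P \<subseteq> ball2 d R \<Longrightarrow>
        \<exists>v\<in>Rn d. inner_Rn d v v = 1 \<and> (\<forall>s\<in>S. inner_Rn d v s = 0) \<and>
          (\<forall>x\<in>P. \<bar>inner_Rn d v x\<bar> \<le> \<delta> / 2)"
  shows "\<exists>v. orthonormal_Rn d (Suc K) v \<and>
    (\<forall>l. J \<le> l \<longrightarrow> l \<le> K \<longrightarrow>
      inner_Rn d (v l) (Qout (run Q (chain d \<mu> B a \<delta> K (Suc K) v) T)) = 0)"
proof -
  define F where "F = chain d \<mu> B a \<delta> K"
  \<comment> \<open>Invariant after \<open>i\<close> directions: the newest one is in the dead zone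
    for all queries of the first \<open>i\<close> blocks, and the current output is orthogonal to
    every direction from index \<open>J\<close> on. Only the newest direction matters, since it is
    the one that the next link touches.\<close>
  have "\<exists>v. orthonormal_Rn d i v \<and>
      (0 < i \<longrightarrow> (\<forall>t<min T (i * m).
        \<bar>inner_Rn d (v (i - 1)) (Q t (run Q (F i v) t))\<bar> \<le> \<delta> / 2)) \<and>
      (\<forall>l. J \<le> l \<longrightarrow> l < i \<longrightarrow> inner_Rn d (v l) (Qout (run Q (F i v) T)) = 0)"
    if "i \<le> Suc K" for i
    using that
  proof (induction i)
    case 0
    show ?case by (simp add: orthonormal_Rn_def)
  next
    case (Suc i)
    then obtain v where v: "orthonormal_Rn d i v"
      "0 < i \<Longrightarrow> \<forall>t<min T (i * m). \<bar>inner_Rn d (v (i - 1)) (Q t (run Q (F i v) t))\<bar> \<le> \<delta> / 2"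
      "\<forall>l. J \<le> l \<longrightarrow> l < i \<longrightarrow> inner_Rn d (v l) (Qout (run Q (F i v) T)) = 0"
      by auto
    define x where "x t = Q t (run Q (F i v) t)" for t
    define out where "out = Qout (run Q (F i v) T)"
    \<comment> \<open>Exact orthogonality is imposed to the previous directions, to the queries of
      block \<open>i\<close>, and to the output on the current objective; smallness is imposed on
      the earlier queries \<open>P\<close>.\<close>
    define S where "S = v ` {..<i} \<union> x ` {i * m..<Suc i * m} \<union> {out}"
    define P where "P = x ` {..<min T (i * m)}"
    have "card S \<le> i + m + 1"
    proof -
      have "card (v ` {..<i}) \<le> i" "card (x ` {i * m..<Suc i * m}) \<le> m"
        using card_image_le[of "{..<i}" v] card_image_le[of "{i * m..<Suc i * m}" x] by auto
      then show ?thesis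
        unfolding S_def using card_Un_le[of "v ` {..<i} \<union> x ` {i * m..<Suc i * m}" "{out}"]
          card_Un_le[of "v ` {..<i}" "x ` {i * m..<Suc i * m}"] by simp
    qed
    moreover have "P \<subseteq> ball2 d R" using query_in_ball2[OF alg] by (auto simp: P_def x_def)
    moreover have "card P \<le> T"
      unfolding P_def using card_image_le[of "{..<min T (i * m)}" x] by simp
    ultimately obtain u where u: "u \<in> Rn d" "inner_Rn d u u = 1" "\<forall>s\<in>S. inner_Rn d u s = 0"
      "\<forall>y\<in>P. \<bar>inner_Rn d u y\<bar> \<le> \<delta> / 2"
      using hidden[of S P] Suc.prems by (auto simp: S_def P_def)
    define v' where "v' = v(i := u)"
    have ux: "\<bar>inner_Rn d u (x t)\<bar> \<le> \<delta> / 2" if "t < min T (Suc i * m)" for t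
    proof (cases "t < i * m")
      case True
      then show ?thesis using u(4) that by (auto simp: P_def)
    next
      case False
      then have "x t \<in> S" using that by (auto simp: S_def)
      then show ?thesis using u(3) \<open>0 \<le> \<delta>\<close> by auto
    qed
    have "chain_coord d i v' = chain_coord d i v"
      by (auto simp: fun_eq_iff chain_coord_def v'_def)
    then have Fv: "F i v' = F i v" by (simp add: fun_eq_iff F_def chain_def)
    \<comment> \<open>Earlier queries fall under the dead-zone case of \<open>chain_Suc_eq\<close>,
      those of block \<open>i\<close> under the orthogonal case.\<close>
    have same: "F (Suc i) v' (x t) = F i v (x t)" if t: "t < min T (Suc i * m)" for t
    proof -
      have "F (Suc i) v' (x t) = F i v' (x t)"
        unfolding F_def
      proof (rule chain_Suc_eq, cases "t < i * m")
        case True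
        then have "0 < i" by (cases i) auto
        moreover from this have "i - 1 \<noteq> i" by linarith
        then have "v' (i - 1) = v (i - 1)" "v' i = u" by (simp_all only: v'_def fun_upd_apply if_False if_True simp_thms)
        ultimately show "inner_Rn d (v' i) (x t) = 0 \<or> 0 < i \<and>
            \<bar>inner_Rn d (v' (i - 1)) (x t)\<bar> \<le> \<delta> / 2 \<and> \<bar>inner_Rn d (v' i) (x t)\<bar> \<le> \<delta> / 2"
          using v(2) t True ux[OF t] by (simp add: x_def)
      next
        case False
        then show "inner_Rn d (v' i) (x t) = 0 \<or> 0 < i \<and>
            \<bar>inner_Rn d (v' (i - 1)) (x t)\<bar> \<le> \<delta> / 2 \<and> \<bar>inner_Rn d (v' i) (x t)\<bar> \<le> \<delta> / 2"
          using u(3) t by (simp add: v'_def S_def)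
      qed
      then show ?thesis by (simp add: Fv)
    qed
    have runs: "run Q (F (Suc i) v') t = run Q (F i v) t" if "t \<le> min T (Suc i * m)" for t
      by (rule run_cong) (use same that in \<open>simp add: x_def\<close>)
    \<comment> \<open>From \<open>i = J\<close> on, all \<open>T\<close> queries lie in the blocks
      already treated, so the entire run and its output are frozen.\<close>
    have out: "Qout (run Q (F (Suc i) v') T) = out" if "J \<le> i"
    proof -
      have "T \<le> Suc i * m" using T mult_le_mono1[of J "Suc i" m] that by linarith
      then show ?thesis using runs[of T] by (simp add: out_def)
    qed
    have u0: "inner_Rn d (v l) u = 0" "inner_Rn d u (v l) = 0" if "l < i" for l
      using u(3) that by (auto simp: S_def inner_Rn_commute[of d "v l"])
    show ?case
    proof (intro exI[of _ v'] conjI allI impI)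
      show "orthonormal_Rn d (Suc i) v'"
        using v(1) u u0 by (auto simp: orthonormal_Rn_def v'_def less_Suc_eq)
      show "\<bar>inner_Rn d (v' (Suc i - 1)) (Q t (run Q (F (Suc i) v') t))\<bar> \<le> \<delta> / 2"
        if "t < min T (Suc i * m)" for t
        using ux[OF that] runs[of t] that by (simp add: v'_def x_def)
      show "inner_Rn d (v' l) (Qout (run Q (F (Suc i) v') T)) = 0" if l: "J \<le> l" "l < Suc i" for l
      proof (cases "l = i")
        case True
        then show ?thesis using u(3) l out by (simp add: v'_def S_def)
      next
        case False
        then show ?thesis using v(3) l out by (simp add: v'_def out_def)
      qed
    qed
  qed
  from this[of "Suc K"] show ?thesis by (auto simp: F_def less_Suc_eq_le)
qed

text \<open>All answers are those of a quadratic whose minimiser is orthogonal to everything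
  queried. The queries and the output are fewer than \<open>d\<close> points, so such a minimiser of
  norm R/2 exists.\<close>

lemma lower_bound_dimension:
  assumes alg: "algorithm d R T Q Qout" and T: "T + 1 < d" and "0 < R" "0 < \<mu>" "\<mu> \<le> \<beta>"
  shows "\<exists>f\<in>obj_class d R \<mu> \<beta>. \<mu> * R\<^sup>2 / 8 \<le> f (Qout (run Q f T)) - min_value d f"
proof -
  \<comment> \<open>The common value of \<open>\<mu> / 2 * (norm_Rn d (x - p))\<^sup>2\<close> over
    all \<open>p\<close> of norm R/2 orthogonal to \<open>x\<close>; it can be fixed before
    \<open>p\<close> is known.\<close>
  define g where "g x = \<mu> / 2 * ((norm_Rn d x)\<^sup>2 + R\<^sup>2 / 4)" for x
  define x where "x t = Q t (run Q g t)" for t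
  define S where "S = x ` {..<T} \<union> {Qout (run Q g T)}"
  have "card S < d"
    unfolding S_def
    using card_Un_le[of "x ` {..<T}" "{Qout (run Q g T)}"] card_image_le[of "{..<T}" x] T by simp
  then obtain v where v: "v \<in> Rn d" "inner_Rn d v v = 1" "\<forall>s\<in>S. inner_Rn d v s = 0"
    using exists_unit_orthogonal[of S d] by (auto simp: S_def)
  define p where "p = (\<lambda>i. R / 2 * v i)"
  define f where "f y = \<mu> / 2 * (norm_Rn d (y - p))\<^sup>2" for y
  have pp: "inner_Rn d p p = (R / 2)\<^sup>2" unfolding p_def inner_Rn_simps v(2) by (simp add: power2_eq_square)
  then have p: "p \<in> ball2 d (R / 2)"
    using v(1) \<open>0 < R\<close> norm_Rn_le_iff[of "R / 2" d p] by (simp add: ball2_def) (simp add: p_def Rn_iff)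
  \<comment> \<open>The empty ridge sum leaves the pure quadratic.\<close>
  have "smooth_strongly_convex d \<mu> \<beta>
      (\<lambda>x. 0 * (\<Sum>l<0::nat. 0) + \<mu> / 2 * (norm_Rn d (x - p))\<^sup>2)
      (\<lambda>x i. 0 * (\<Sum>l<0::nat. 0 * 0) + \<mu> * (x - p) i)"
    by (rule ridge_smooth_strongly_convex[where u = "\<lambda>_ _. 0" and k = 0 and B = 0
          and \<phi> = "\<lambda>_ _. 0" and \<phi>' = "\<lambda>_ _. 0"]) (use p assms in \<open>auto simp: ball2_def\<close>)
  then obtain G where G: "smooth_strongly_convex d \<mu> \<beta> f G" by (simp add: f_def[abs_def])
  have fp: "f p = 0" by (simp add: f_def norm_Rn_def L2_set_def)
  have f_ge: "f p \<le> f y" for y unfolding fp using \<open>0 < \<mu>\<close> by (simp add: f_def)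
  have fg: "f y = g y" if "y \<in> S" for y
  proof -
    have "inner_Rn d p y = 0" using v(3) that unfolding p_def inner_Rn_simps by simp
    then have "(norm_Rn d (y - p))\<^sup>2 = (norm_Rn d y)\<^sup>2 + R\<^sup>2 / 4"
      using pp unfolding norm_Rn_power2
      by (simp add: inner_Rn_diff_left inner_Rn_diff_right inner_Rn_commute[of d y p] power_divide)
    then show ?thesis by (simp add: f_def g_def)
  qed
  have runs: "run Q f t = run Q g t" if "t \<le> T" for t
    by (rule run_cong) (use fg that in \<open>auto simp: x_def S_def\<close>)
  have "f (Qout (run Q f T)) = g (Qout (run Q g T))" using fg runs by (simp add: S_def)
  also have "\<dots> \<ge> \<mu> / 2 * (R\<^sup>2 / 4)"
    unfolding g_def using \<open>0 < \<mu>\<close> by (intro mult_left_mono) auto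
  finally have "\<mu> * R\<^sup>2 / 8 \<le> f (Qout (run Q f T))" by simp
  moreover have "f \<in> obj_class d R \<mu> \<beta>" "min_value d f = f p"
    using obj_classI[OF G \<open>0 < \<mu>\<close> _ p f_ge] assms by auto
  ultimately show ?thesis using fp by (intro bexI[of _ f]) auto
qed

text \<open>A chain of \<open>2 * J\<close> coordinates with blocks of \<open>d div 8\<close>
  queries: the last \<open>J\<close> directions stay orthogonal to the output, and the minimiser has
  coordinates at least \<open>a / 2\<close> along them.\<close>

lemma lower_bound_chain:
  assumes alg: "algorithm d R T Q Qout" and "0 < R" "0 < \<mu>" and \<kappa>: "\<kappa> = \<beta> / \<mu>" "1024 \<le> \<kappa>"
    and d: "2 \<le> d" and \<kappa>_le: "\<kappa> * sqrt \<kappa> * ln (exp 1 * real d) \<le> real d"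
    and T: "T < nat \<lfloor>sqrt \<kappa> / 32\<rfloor> * (d div 8)"
  shows "\<exists>f\<in>obj_class d R \<mu> \<beta>. \<mu> * R\<^sup>2 / 128 \<le> f (Qout (run Q f T)) - min_value d f"
proof -
  define J where "J = nat \<lfloor>sqrt \<kappa> / 32\<rfloor>"
  define m where "m = d div 8"
  have "32 \<le> sqrt \<kappa>" using \<kappa>(2) by (simp add: real_le_rsqrt)
  then have J: "1 \<le> J" "32 * real J \<le> sqrt \<kappa>"
    unfolding J_def by linarith+
  define K where "K = 2 * J - 1"
  have SucK: "Suc K = 2 * J" using J(1) by (simp add: K_def)
  define k where "k = real (Suc K)"
  have k: "0 < k" "16 * k \<le> sqrt \<kappa>" using J by (auto simp: k_def SucK)
  have \<kappa>0: "0 < \<kappa>" using \<kappa>(2) by simp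
  \<comment> \<open>Gives k a^2 = R^2/4, so that the norm bound of \<open>chain_minimizer\<close>
    places the minimiser in the ball of radius R/2.\<close>
  define a where "a = R / (2 * sqrt k)"
  \<comment> \<open>The widest dead zone that \<open>chain_minimizer\<close> admits.\<close>
  define \<delta> where "\<delta> = a / (4 * k)"
  \<comment> \<open>Spends the whole smoothness budget:
    \<open>4 * B + \<mu> = \<beta>\<close>.\<close>
  define B where "B = (\<beta> - \<mu>) / 4"
  have a: "0 < a" using \<open>0 < R\<close> k by (simp add: a_def)
  have \<delta>: "0 < \<delta>" using a k by (simp add: \<delta>_def)
  have a2: "k * a\<^sup>2 = R\<^sup>2 / 4" using k by (simp add: a_def power_divide power_mult_distrib)
  have \<beta>: "\<beta> = \<kappa> * \<mu>" using \<kappa>(1) \<open>0 < \<mu>\<close> by simp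
  have "1024 * \<mu> \<le> \<beta>" unfolding \<beta> using \<kappa>(2) \<open>0 < \<mu>\<close> by simp
  have "(16 * k)\<^sup>2 \<le> \<kappa>" using k \<kappa>0 by (metis real_sqrt_pow2 less_imp_le power_mono mult_nonneg_nonneg zero_le_numeral)
  then have "256 * k\<^sup>2 * \<mu> \<le> \<beta>" unfolding \<beta> using \<open>0 < \<mu>\<close> by (simp add: power_mult_distrib)
  then have short: "16 * \<mu> * k\<^sup>2 \<le> B"
    using \<open>1024 * \<mu> \<le> \<beta>\<close> \<open>0 < \<mu>\<close> unfolding B_def by (simp add: mult.commute mult.left_commute)
  have B: "0 < B" using \<open>1024 * \<mu> \<le> \<beta>\<close> \<open>0 < \<mu>\<close> by (simp add: B_def)
  have B4: "4 * B + \<mu> \<le> \<beta>" by (simp add: B_def field_simps)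
  have ln1: "1 \<le> ln (exp 1 * real d)" using d by (simp add: ln_mult)
  have "sqrt \<kappa> \<le> \<kappa> * sqrt \<kappa>" using \<kappa>(2) by (simp add: mult_le_cancel_right1)
  also have "\<dots> \<le> \<kappa> * sqrt \<kappa> * ln (exp 1 * real d)"
    using mult_left_mono[OF ln1, of "\<kappa> * sqrt \<kappa>"] \<kappa>0 by simp
  finally have sqrt_le_d: "sqrt \<kappa> \<le> real d" using \<kappa>_le by linarith
  have "real (16 * Suc K) \<le> real d" using k(2) sqrt_le_d by (simp add: k_def)
  then have Kd: "16 * Suc K \<le> d" by (simp only: of_nat_le_iff)
  have "T < d * d"
  proof -
    have "T < J * m" using T by (simp add: J_def m_def)
    also have "\<dots> \<le> d * d" by (rule mult_le_mono) (use Kd SucK in \<open>auto simp: m_def\<close>)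
    finally show ?thesis .
  qed
  \<comment> \<open>Dimensions left for the random signs: \<open>K + d div 8 + 1 + d div 2\<close>
    is at most \<open>d\<close>.\<close>
  define n where "n = d div 2"
  have n: "0 < n" "real d \<le> 4 * real n" using d by (auto simp: n_def)
  \<comment> \<open>The bound on \<kappa> enters here: (\<delta>/2)^2 is R^2/(256 k^3), and k^3 is
    at most \<kappa>^(3/2)/4096. The left side is the logarithm of (ed)^2, which dominates twice the
    fewer than d^2 earlier queries.\<close>
  have exponent: "2 * ln (exp 1 * real d) \<le> real n * (\<delta> / 2)\<^sup>2 / (2 * R\<^sup>2)"
  proof -
    have "(\<delta> / 2)\<^sup>2 = R\<^sup>2 / (256 * k ^ 3)"
      using k by (simp add: \<delta>_def a_def power_divide power_mult_distrib)
        (simp add: power2_eq_square power3_eq_cube)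
    then have eq: "real n * (\<delta> / 2)\<^sup>2 / (2 * R\<^sup>2) = real n / (512 * k ^ 3)"
      using \<open>0 < R\<close> by simp
    have "(16 * k) ^ 3 \<le> sqrt \<kappa> ^ 3" using k by (intro power_mono) auto
    then have "4096 * k ^ 3 \<le> \<kappa> * sqrt \<kappa>"
      using \<kappa>0 by (simp add: power_mult_distrib power3_eq_cube)
    then have "4096 * k ^ 3 * ln (exp 1 * real d) \<le> \<kappa> * sqrt \<kappa> * ln (exp 1 * real d)"
      using ln1 by (intro mult_right_mono) auto
    also have "\<dots> \<le> 4 * real n" using \<kappa>_le n by linarith
    finally have "2 * ln (exp 1 * real d) * (512 * k ^ 3) \<le> real n" by (simp add: mult.commute)
    then show ?thesis unfolding eq using k by (simp add: pos_le_divide_eq)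
  qed
  have hidden: "\<exists>v\<in>Rn d. inner_Rn d v v = 1 \<and> (\<forall>s\<in>S. inner_Rn d v s = 0) \<and>
          (\<forall>x\<in>P. \<bar>inner_Rn d v x\<bar> \<le> \<delta> / 2)"
    if S: "finite S" "card S \<le> K + m + 1" and P: "finite P" "card P \<le> T" "P \<subseteq> ball2 d R" for S P
  proof (rule exists_nearly_orthogonal_unit)
    show "card S + n \<le> d" using S Kd by (simp add: n_def m_def)
    have "2 * real (card P) \<le> 2 * real (d * d)" using P(2) \<open>T < d * d\<close>
      by (intro mult_left_mono) (auto simp del: of_nat_mult)
    also have "\<dots> < exp 1 * exp 1 * (real d * real d)"
    proof -
      have "2 \<le> exp (1::real)" using exp_ge_add_one_self[of 1] by simp
      then have "2 * 2 \<le> exp 1 * exp (1::real)" by (intro mult_mono) auto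
      then have "2 < exp 1 * exp (1::real)" by linarith
      then show ?thesis using d by (simp add: mult_less_cancel_right_pos)
    qed
    also have "\<dots> = exp (2 * ln (exp 1 * real d))"
    proof -
      have "exp (ln (exp 1 * real d)) = exp 1 * real d" using d by (subst exp_ln) auto
      then show ?thesis by (simp only: mult_2 exp_add mult_ac)
    qed
    also have "\<dots> \<le> exp (real n * (\<delta> / 2)\<^sup>2 / (2 * R\<^sup>2))" using exponent by simp
    finally show "2 * real (card P) < exp (real n * (\<delta> / 2)\<^sup>2 / (2 * R\<^sup>2))" .
  qed (use S P n \<open>0 < R\<close> \<delta> in \<open>auto simp: ball2_def\<close>)
  obtain v where v: "orthonormal_Rn d (Suc K) v"
    "\<forall>l. J \<le> l \<longrightarrow> l \<le> K \<longrightarrow>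
      inner_Rn d (v l) (Qout (run Q (chain d \<mu> B a \<delta> K (Suc K) v) T)) = 0"
    using resisting_chain[where J = J and m = m and \<mu> = \<mu> and B = B and a = a,
        OF alg _ less_imp_le[OF \<delta>] hidden] T
    unfolding J_def m_def by (auto simp: less_imp_le)
  define f where "f = chain d \<mu> B a \<delta> K (Suc K) v"
  define out where "out = Qout (run Q f T)"
  obtain G where G: "smooth_strongly_convex d \<mu> \<beta> f G"
    using chain_smooth_strongly_convex[OF v(1), of B \<mu> \<beta> \<delta> a] B \<open>0 < \<mu>\<close> \<delta>
      B4
    unfolding f_def by (auto simp: less_imp_le)
  have "\<mu> / 2 * (norm_Rn d x)\<^sup>2 \<le> f x" for x
    unfolding f_def chain_def using B by (simp add: sum_nonneg)
  then obtain z where z: "z \<in> Rn d" "\<And>y. y \<in> Rn d \<Longrightarrow> f z \<le> f y"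
    using exists_minimizer_Rn[of d f "\<mu> / 2"] smooth_strongly_convex_continuous[OF G] \<open>0 < \<mu>\<close>
    by auto
  have narrow: "4 * k * \<delta> \<le> a" using k by (simp add: \<delta>_def)
  have min: "(norm_Rn d z)\<^sup>2 \<le> real (Suc K) * a\<^sup>2" "l \<le> K \<Longrightarrow> a / 2 \<le> inner_Rn d (v l) z" for l
    using chain_minimizer[OF v(1) B \<open>0 < \<mu>\<close> less_imp_le[OF \<delta>] a short[unfolded k_def]
        narrow[unfolded k_def], of z] z(2) unfolding f_def by blast+
  have "inner_Rn d z z \<le> (R / 2)\<^sup>2"
    using min(1) a2 by (simp add: k_def norm_Rn_power2 power_divide)
  then have z_ball: "z \<in> ball2 d (R / 2)"
    using z(1) \<open>0 < R\<close> norm_Rn_le_iff[of "R / 2" d z] by (simp add: ball2_def)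
  have out: "out \<in> Rn d" using output_in_ball2[OF alg, of f] by (simp add: out_def ball2_def)
  \<comment> \<open>Bessel along the hidden half of the directions bounds the distance from the
    output to the minimiser from below.\<close>
  have "real J * (a\<^sup>2 / 4) = (\<Sum>l\<in>{J..<2 * J}. (a / 2)\<^sup>2)" by (simp add: power_divide)
  also have "\<dots> \<le> (\<Sum>l\<in>{J..<2 * J}. (inner_Rn d (v l) (out - z))\<^sup>2)"
  proof (rule sum_mono)
    fix l assume l: "l \<in> {J..<2 * J}"
    then have lK: "J \<le> l" "l \<le> K" using SucK by auto
    have "inner_Rn d (v l) out = 0" using v(2) lK unfolding out_def f_def by blast
    then have "(inner_Rn d (v l) (out - z))\<^sup>2 = (inner_Rn d (v l) z)\<^sup>2" by (simp add: inner_Rn_simps)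
    then show "(a / 2)\<^sup>2 \<le> (inner_Rn d (v l) (out - z))\<^sup>2"
      using min(2)[OF lK(2)] a by (simp add: power_mono)
  qed
  also have "\<dots> \<le> (\<Sum>l<Suc K. (inner_Rn d (v l) (out - z))\<^sup>2)"
    by (rule sum_mono2) (use SucK in auto)
  also have "\<dots> \<le> (norm_Rn d (out - z))\<^sup>2" unfolding norm_Rn_power2 by (rule bessel_Rn[OF v(1)])
  finally have "real J * (a\<^sup>2 / 4) \<le> (norm_Rn d (out - z))\<^sup>2" .
  moreover have "real J * (a\<^sup>2 / 4) = R\<^sup>2 / 32" using a2 by (simp add: k_def SucK)
  ultimately have "\<mu> / 4 * (R\<^sup>2 / 32) \<le> \<mu> / 4 * (norm_Rn d (out - z))\<^sup>2"
    using \<open>0 < \<mu>\<close> by (intro mult_left_mono) auto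
  then have "\<mu> * R\<^sup>2 / 128 \<le> f out - f z"
    using smooth_strongly_convex_growth[OF G out z] by simp
  moreover have "f \<in> obj_class d R \<mu> \<beta>" "min_value d f = f z"
    using obj_classI[OF G \<open>0 < \<mu>\<close> _ z_ball z(2)] \<open>1024 * \<mu> \<le> \<beta>\<close> \<open>0 < \<mu>\<close> by auto
  ultimately show ?thesis unfolding out_def by (intro bexI[of _ f]) auto
qed

text \<open>For \<kappa> < 1024 the dimension bound suffices, as sqrt \<kappa> is absorbed in the
  constant; otherwise the chain applies. Both forced errors, \<mu>R^2/8 and \<mu>R^2/128, exceed
  \<epsilon>.\<close>

lemma lower_bound:
  assumes alg: "algorithm d R T Q Qout"
    and err: "\<And>f. f \<in> obj_class d R \<mu> \<beta> \<Longrightarrow> f (Qout (run Q f T)) - min_value d f \<le> \<epsilon>"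
    and "0 < R" "0 < \<mu>" "\<mu> \<le> \<beta>" and \<kappa>: "\<kappa> = \<beta> / \<mu>" and d: "8 \<le> d"
    and \<kappa>_le: "\<kappa> \<le> (real d / ln (exp 1 * real d)) powr (2 / 3)"
    and \<epsilon>: "\<epsilon> \<le> 1 / 256 * \<mu> * R\<^sup>2"
  shows "1 / 1024 * real d * sqrt \<kappa> \<le> real T"
proof -
  have pos: "0 < \<mu> * R\<^sup>2" using assms by simp
  show ?thesis
  proof (cases "\<kappa> < 1024")
    case True
    have dim: "\<not> T + 1 < d"
      using lower_bound_dimension[OF alg _ \<open>0 < R\<close> \<open>0 < \<mu>\<close> \<open>\<mu> \<le> \<beta>\<close>] err \<epsilon> pos by force
    have "sqrt \<kappa> \<le> 32" using True by (intro real_le_lsqrt) auto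
    then have "real d * sqrt \<kappa> \<le> real d * 32" by (intro mult_left_mono) auto
    moreover have "d \<le> 32 * T" using d dim by linarith
    then have "real d \<le> real (32 * T)" by (simp only: of_nat_le_iff)
    ultimately show ?thesis by simp
  next
    case False
    then have \<kappa>': "1024 \<le> \<kappa>" by simp
    have ln: "0 < ln (exp 1 * real d)" using d by (simp add: ln_mult add_pos_nonneg)
    \<comment> \<open>The hypothesis on \<kappa> raised to the power 3/2.\<close>
    have "\<kappa> * sqrt \<kappa> = \<kappa> powr (3 / 2)"
      using \<kappa>' powr_add[of \<kappa> 1 "1/2"] by (simp add: powr_half_sqrt)
    also have "\<dots> \<le> ((real d / ln (exp 1 * real d)) powr (2 / 3)) powr (3 / 2)"
      using \<kappa>_le \<kappa>' by (intro powr_mono2) auto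
    also have "\<dots> = real d / ln (exp 1 * real d)" using d ln by (simp add: powr_powr)
    finally have "\<kappa> * sqrt \<kappa> * ln (exp 1 * real d) \<le> real d" using ln by (simp add: field_simps)
    then have T: "nat \<lfloor>sqrt \<kappa> / 32\<rfloor> * (d div 8) \<le> T"
      using lower_bound_chain[OF alg \<open>0 < R\<close> \<open>0 < \<mu>\<close> \<kappa> \<kappa>'] err \<epsilon> pos d by force
    \<comment> \<open>Rounding down loses at most a factor of two in each of sqrt \<kappa> / 32 and
      d / 8, whence 1/64 times 1/16.\<close>
    have "32 \<le> sqrt \<kappa>" using \<kappa>' by (simp add: real_le_rsqrt)
    then have "1 \<le> nat \<lfloor>sqrt \<kappa> / 32\<rfloor>" "sqrt \<kappa> / 32 < real (nat \<lfloor>sqrt \<kappa> / 32\<rfloor>) + 1"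
      by linarith+
    then have "sqrt \<kappa> / 64 \<le> real (nat \<lfloor>sqrt \<kappa> / 32\<rfloor>)" by simp
    moreover have "d \<le> 16 * (d div 8)" using d by presburger
    then have "real d \<le> real (16 * (d div 8))" by (simp only: of_nat_le_iff)
    then have "real d / 16 \<le> real (d div 8)" by simp
    ultimately have "sqrt \<kappa> / 64 * (real d / 16) \<le> real (nat \<lfloor>sqrt \<kappa> / 32\<rfloor>) * real (d div 8)"
      using \<kappa>' by (intro mult_mono) auto
    also have "\<dots> \<le> real T" using T by (simp only: of_nat_mult[symmetric] of_nat_le_iff)
    finally show ?thesis by (simp add: mult.commute)
  qed
qed

section \<open>Restarted accelerated projected descent with inexact gradients\<close>

text \<open>Metric projection onto the ball for \<open>0 < r\<close>; the maximum covers points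
  inside and outside at once.\<close>

definition ball_proj :: "nat \<Rightarrow> real \<Rightarrow> (nat \<Rightarrow> real) \<Rightarrow> nat \<Rightarrow> real" where
  "ball_proj d r x = (\<lambda>i. r / max r (norm_Rn d x) * x i)"

lemma ball_proj_in_ball2:
  assumes "0 < r" "x \<in> Rn d"
  shows "ball_proj d r x \<in> ball2 d r"
proof -
  have "norm_Rn d (ball_proj d r x) = r / max r (norm_Rn d x) * norm_Rn d x"
    unfolding ball_proj_def norm_Rn_scale using assms by simp
  also have "\<dots> \<le> r / max r (norm_Rn d x) * max r (norm_Rn d x)"
    using assms by (intro mult_left_mono) auto
  also have "\<dots> = r" using assms by simp
  finally show ?thesis using assms by (simp add: ball2_def) (simp add: ball_proj_def Rn_iff)
qed

text \<open>Outside the ball, \<open>x\<close> minus its projection is a nonnegative multiple of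
  \<open>x\<close>, and among points of the ball the projection maximises the inner product with
  \<open>x\<close>.\<close>

lemma ball_proj_variational:
  assumes "0 < r" "u \<in> ball2 d r"
  shows "inner_Rn d (x - ball_proj d r x) (u - ball_proj d r x) \<le> 0"
proof (cases "norm_Rn d x \<le> r")
  case True
  then have "x - ball_proj d r x = (\<lambda>_. 0)"
    using assms by (auto simp: ball_proj_def)
  then show ?thesis by (simp add: inner_Rn_def)
next
  case False
  define N where "N = norm_Rn d x"
  have N: "r < N" "0 < N" using False \<open>0 < r\<close> by (auto simp: N_def)
  define p where "p = ball_proj d r x"
  have p: "p = (\<lambda>i. r / N * x i)" using N by (simp add: p_def ball_proj_def N_def[symmetric])
  have xp: "x - p = (\<lambda>i. (1 - r / N) * x i)" by (auto simp: p algebra_simps)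
  have "inner_Rn d x u \<le> N * norm_Rn d u"
    unfolding N_def by (rule order_trans[OF abs_ge_self inner_Rn_le_norm])
  also have "\<dots> \<le> N * r" using assms(2) N by (intro mult_left_mono) (auto simp: ball2_def)
  finally have "inner_Rn d x u \<le> N * r" .
  moreover have "inner_Rn d x p = r * N"
    unfolding p inner_Rn_scale_right norm_Rn_power2[symmetric] N_def[symmetric]
    using N by (simp add: power2_eq_square)
  ultimately have "inner_Rn d x (u - p) \<le> 0" by (simp add: inner_Rn_diff_right mult.commute)
  then show ?thesis
    unfolding p_def[symmetric] xp inner_Rn_scale_left using N by (intro mult_nonneg_nonpos) auto
qed

definition lincomb :: "real \<Rightarrow> (nat \<Rightarrow> real) \<Rightarrow> (nat \<Rightarrow> real) \<Rightarrow> nat \<Rightarrow> real" where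
  "lincomb \<theta> x z = (\<lambda>i. (1 - \<theta>) * x i + \<theta> * z i)"

lemma lincomb_in_ball2:
  assumes "x \<in> ball2 d r" "z \<in> ball2 d r" "0 \<le> \<theta>" "\<theta> \<le> 1"
  shows "lincomb \<theta> x z \<in> ball2 d r"
proof -
  have "norm_Rn d (lincomb \<theta> x z) \<le> (1 - \<theta>) * norm_Rn d x + \<theta> * norm_Rn d z"
    unfolding lincomb_def using norm_Rn_add[of d "\<lambda>i. (1 - \<theta>) * x i" "\<lambda>i. \<theta> * z i"] assms
    by (simp add: norm_Rn_scale)
  also have "\<dots> \<le> (1 - \<theta>) * r + \<theta> * r"
    using assms by (intro add_mono mult_left_mono) (auto simp: ball2_def)
  finally show ?thesis using assms by (simp add: ball2_def algebra_simps) (simp add: lincomb_def Rn_iff)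
qed

text \<open>The step is that of the accelerated method of Auslender, Teboulle and Tseng, whose iterates
  stay in the ball as convex combinations of projected points.\<close>

definition prox_point where
  "prox_point d r \<beta> \<theta> g z = ball_proj d r (\<lambda>i. z i - 1 / (2 * \<beta> * \<theta>) * g i)"

text \<open>Smoothness from \<open>y\<close> to \<open>x'\<close>, convexity from \<open>y\<close>
  to \<open>x\<close> and to \<open>u\<close>, and the projection inequality for \<open>z'\<close>.
  The step length 1/(2\<beta>\<theta>) is matched to the smoothness constant \<beta>, so that the
  squared distances from \<open>z'\<close> to \<open>z\<close> cancel.\<close>

lemma accelerated_step:
  assumes f: "smooth_strongly_convex d \<mu> \<beta> f G" and "0 \<le> \<mu>" "0 < \<beta>" "0 < r"
    and x: "x \<in> ball2 d r" and z: "z \<in> ball2 d r" and u: "u \<in> ball2 d r"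
    and \<theta>: "0 < \<theta>" "\<theta> \<le> 1" and g: "g \<in> Rn d"
    and \<eta>: "norm_Rn d (G (lincomb \<theta> x z) - g) \<le> \<eta>"
    and z': "z' = prox_point d r \<beta> \<theta> g z" and x': "x' = lincomb \<theta> x z'"
  shows "f x' - f u + \<beta> * \<theta>\<^sup>2 * (norm_Rn d (z' - u))\<^sup>2
    \<le> (1 - \<theta>) * (f x - f u) + \<beta> * \<theta>\<^sup>2 * (norm_Rn d (z - u))\<^sup>2 + \<theta> * (2 * r * \<eta>)"
proof -
  define y where "y = lincomb \<theta> x z"
  define w where "w = (\<lambda>i. z i - 1 / (2 * \<beta> * \<theta>) * g i)"
  have wR: "w \<in> Rn d" using z g by (simp add: w_def ball2_def Rn_iff)
  have z'w: "z' = ball_proj d r w" by (simp add: z' prox_point_def w_def)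
  have z'b: "z' \<in> ball2 d r" unfolding z'w by (rule ball_proj_in_ball2[OF \<open>0 < r\<close> wR])
  have yb: "y \<in> ball2 d r" unfolding y_def using x z \<theta> by (intro lincomb_in_ball2) auto
  have x'b: "x' \<in> ball2 d r" unfolding x' using x z'b \<theta> by (intro lincomb_in_ball2) auto
  have Rn: "x \<in> Rn d" "y \<in> Rn d" "x' \<in> Rn d" "u \<in> Rn d"
    using x yb x'b u by (auto simp: ball2_def)
  have x'y: "x' - y = (\<lambda>i. \<theta> * (z' - z) i)" by (auto simp: x' y_def lincomb_def algebra_simps)
  have x'y2: "x' - y = (\<lambda>i. (1 - \<theta>) * (x - y) i + \<theta> * ((u - y) i + (z' - u) i))"
    by (auto simp: x' lincomb_def algebra_simps)
  have "f x' \<le> f y + inner_Rn d (G y) (x' - y) + \<beta> * (norm_Rn d (x' - y))\<^sup>2"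
    by (rule smooth_strongly_convex_upper[OF f \<open>0 \<le> \<mu>\<close> Rn(2,3)])
  also have "(norm_Rn d (x' - y))\<^sup>2 = \<theta>\<^sup>2 * (norm_Rn d (z' - z))\<^sup>2"
    unfolding x'y norm_Rn_scale power_mult_distrib power2_abs ..
  also have "inner_Rn d (G y) (x' - y) = (1 - \<theta>) * inner_Rn d (G y) (x - y)
      + \<theta> * (inner_Rn d (G y) (u - y) + inner_Rn d (G y) (z' - u))"
    unfolding x'y2 inner_Rn_add_right inner_Rn_scale_right ..
  finally have 1: "f x' \<le> (1 - \<theta>) * (f y + inner_Rn d (G y) (x - y))
      + \<theta> * (f y + inner_Rn d (G y) (u - y)) + \<theta> * inner_Rn d (G y) (z' - u)
      + \<beta> * \<theta>\<^sup>2 * (norm_Rn d (z' - z))\<^sup>2"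
    by (simp add: algebra_simps fun_diff_def)
  have lower: "f y + inner_Rn d (G y) (v - y) \<le> f v" if "v \<in> Rn d" for v
  proof -
    have "0 \<le> \<mu> / 2 * (norm_Rn d (v - y))\<^sup>2" using \<open>0 \<le> \<mu>\<close> by simp
    then show ?thesis using smooth_strongly_convex_lower[OF f Rn(2) that] by linarith
  qed
  have 2: "(1 - \<theta>) * (f y + inner_Rn d (G y) (x - y)) + \<theta> * (f y + inner_Rn d (G y) (u - y))
      \<le> (1 - \<theta>) * f x + \<theta> * f u"
    using \<theta> Rn by (intro add_mono mult_left_mono lower) auto
  \<comment> \<open>The gradient error is paid once, against the diameter \<open>2 * r\<close> of
    the ball.\<close>
  have "inner_Rn d (G y - g) (z' - u) \<le> norm_Rn d (G y - g) * norm_Rn d (z' - u)"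
    by (rule order_trans[OF abs_ge_self inner_Rn_le_norm])
  also have "\<dots> \<le> \<eta> * (r + r)"
  proof (rule mult_mono)
    show "norm_Rn d (z' - u) \<le> r + r"
      using norm_Rn_diff_le[of d z' u] z'b u by (simp add: ball2_def)
    show "0 \<le> \<eta>" using \<eta> norm_Rn_nonneg order_trans by blast
  qed (use \<eta> in \<open>auto simp: y_def\<close>)
  finally have 3: "inner_Rn d (G y) (z' - u) \<le> inner_Rn d g (z' - u) + 2 * r * \<eta>"
    by (simp add: inner_Rn_diff_left algebra_simps)
  have "inner_Rn d (w - z') (u - z') \<le> 0"
    unfolding z'w by (rule ball_proj_variational[OF \<open>0 < r\<close> u])
  moreover have "w - z' = (\<lambda>i. (z - z') i + (- 1 / (2 * \<beta> * \<theta>)) * g i)"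
    by (auto simp: w_def)
  ultimately have "inner_Rn d (z - z') (u - z') + (- 1 / (2 * \<beta> * \<theta>)) * inner_Rn d g (u - z') \<le> 0"
    by (simp only: inner_Rn_add_left inner_Rn_scale_left)
  moreover have "inner_Rn d g (u - z') = - inner_Rn d g (z' - u)" by (simp add: inner_Rn_diff_right)
  ultimately have "inner_Rn d g (z' - u) / (2 * \<beta> * \<theta>) \<le> - inner_Rn d (z - z') (u - z')"
    by simp
  then have 4: "inner_Rn d g (z' - u) \<le> - inner_Rn d (z - z') (u - z') * (2 * \<beta> * \<theta>)"
    using \<theta> \<open>0 < \<beta>\<close> by (simp only: pos_divide_le_eq mult_pos_pos zero_less_numeral)
  \<comment> \<open>Three-point identity: the inner product becomes a difference of squared
    distances that telescopes over the steps.\<close>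
  have "- 2 * inner_Rn d (z - z') (u - z')
      = (norm_Rn d (z - u))\<^sup>2 - (norm_Rn d (z' - u))\<^sup>2 - (norm_Rn d (z' - z))\<^sup>2"
    unfolding norm_Rn_power2 inner_Rn_diff_left inner_Rn_diff_right
    by (simp add: inner_Rn_commute[of d u z] inner_Rn_commute[of d z' z] inner_Rn_commute[of d z' u])
  then have "- inner_Rn d (z - z') (u - z') * (2 * \<beta> * \<theta>)
      = \<beta> * \<theta> * ((norm_Rn d (z - u))\<^sup>2 - (norm_Rn d (z' - u))\<^sup>2 - (norm_Rn d (z' - z))\<^sup>2)"
    by (metis (no_types, opaque_lifting) mult.assoc mult.commute mult_minus_left mult_minus_right)
  with 3 4 have "inner_Rn d (G y) (z' - u)
      \<le> \<beta> * \<theta> * ((norm_Rn d (z - u))\<^sup>2 - (norm_Rn d (z' - u))\<^sup>2 - (norm_Rn d (z' - z))\<^sup>2) + 2 * r * \<eta>"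
    by linarith
  then have "\<theta> * inner_Rn d (G y) (z' - u) \<le> \<theta> *
      (\<beta> * \<theta> * ((norm_Rn d (z - u))\<^sup>2 - (norm_Rn d (z' - u))\<^sup>2 - (norm_Rn d (z' - z))\<^sup>2) + 2 * r * \<eta>)"
    using \<theta> by (intro mult_left_mono) auto
  then show ?thesis using 1 2 by (simp add: algebra_simps power2_eq_square)
qed

text \<open>The previous inequality divided by \<theta>^2. The weight t(t+2)/4 of the function gap
  vanishes at t = 0, so an epoch starts from the squared distance alone.\<close>

lemma accelerated_potential_step:
  fixes t :: nat
  assumes f: "smooth_strongly_convex d \<mu> \<beta> f G" and "0 \<le> \<mu>" "0 < \<beta>" "0 < r"
    and x: "x \<in> ball2 d r" and z: "z \<in> ball2 d r" and u: "u \<in> ball2 d r"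
    and min: "\<And>y. y \<in> Rn d \<Longrightarrow> f u \<le> f y"
    and \<theta>: "\<theta> = 2 / (real t + 2)" and g: "g \<in> Rn d"
    and \<eta>: "norm_Rn d (G (lincomb \<theta> x z) - g) \<le> \<eta>"
    and z': "z' = prox_point d r \<beta> \<theta> g z" and x': "x' = lincomb \<theta> x z'" and x'b: "x' \<in> Rn d"
  shows "real (Suc t) * (real (Suc t) + 2) / 4 * (f x' - f u) + \<beta> * (norm_Rn d (z' - u))\<^sup>2
    \<le> real t * (real t + 2) / 4 * (f x - f u) + \<beta> * (norm_Rn d (z - u))\<^sup>2 + r * \<eta> * (real t + 2)"
proof -
  have t2: "0 < real t + 2" by simp
  have \<theta>01: "0 < \<theta>" "\<theta> \<le> 1" by (auto simp: \<theta>)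
  have c: "\<theta> * ((real t + 2) / 2) = 1" unfolding \<theta> using t2 by simp
  then have c2: "\<theta>\<^sup>2 * ((real t + 2) / 2)\<^sup>2 = 1" by (metis power_mult_distrib power_one)
  let ?s = "((real t + 2) / 2)\<^sup>2"
  have "?s * (f x' - f u + \<beta> * \<theta>\<^sup>2 * (norm_Rn d (z' - u))\<^sup>2)
    \<le> ?s * ((1 - \<theta>) * (f x - f u) + \<beta> * \<theta>\<^sup>2 * (norm_Rn d (z - u))\<^sup>2 + \<theta> * (2 * r * \<eta>))"
    by (intro mult_left_mono accelerated_step[OF assms(1-7) \<theta>01 g \<eta> z' x']) simp
  moreover have "?s * (f x' - f u + \<beta> * \<theta>\<^sup>2 * (norm_Rn d (z' - u))\<^sup>2)
      = ?s * (f x' - f u) + (\<theta>\<^sup>2 * ?s) * (\<beta> * (norm_Rn d (z' - u))\<^sup>2)"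
    by (simp only: distrib_left mult_ac)
  moreover have "?s * ((1 - \<theta>) * (f x - f u) + \<beta> * \<theta>\<^sup>2 * (norm_Rn d (z - u))\<^sup>2 + \<theta> * (2 * r * \<eta>))
      = ?s * (1 - \<theta>) * (f x - f u) + (\<theta>\<^sup>2 * ?s) * (\<beta> * (norm_Rn d (z - u))\<^sup>2)
        + (\<theta> * ((real t + 2) / 2)) * (r * \<eta> * (real t + 2))"
  proof -
    have "p\<^sup>2 * ((1 - \<theta>) * A + \<beta> * \<theta>\<^sup>2 * B + \<theta> * (2 * r * \<eta>))
        = p\<^sup>2 * (1 - \<theta>) * A + (\<theta>\<^sup>2 * p\<^sup>2) * (\<beta> * B) + (\<theta> * p) * (r * \<eta> * (2 * p))" for p A B :: real
      by (simp add: algebra_simps power2_eq_square)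
    from this[of "(real t + 2) / 2"] show ?thesis by simp
  qed
  moreover have "?s * (1 - \<theta>) = real t * (real t + 2) / 4"
  proof -
    have "?s * (1 - \<theta>) = ((real t + 2) / 2) * ((real t + 2) / 2 - \<theta> * ((real t + 2) / 2))"
      by (simp only: power2_eq_square algebra_simps)
    then show ?thesis unfolding c by (simp add: field_simps)
  qed
  ultimately have "?s * (f x' - f u) + \<beta> * (norm_Rn d (z' - u))\<^sup>2
      \<le> real t * (real t + 2) / 4 * (f x - f u) + \<beta> * (norm_Rn d (z - u))\<^sup>2 + r * \<eta> * (real t + 2)"
    unfolding c c2 by simp
  \<comment> \<open>(t+1)(t+3) \<le> (t+2)^2, applied to a nonnegative gap.\<close>
  moreover have "real (Suc t) * (real (Suc t) + 2) / 4 * (f x' - f u) \<le> ?s * (f x' - f u)"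
    using min[OF x'b] by (intro mult_right_mono) (auto simp: power2_eq_square field_simps)
  ultimately show ?thesis by linarith
qed

section \<open>The algorithm as a function of its answers\<close>

context
  fixes d :: nat and r \<beta> h :: real and n :: nat
begin

text \<open>The method reads only the answers \<open>V 0, V 1, \<dots>\<close>; step \<open>s\<close> uses the \<open>d + 1\<close> answers from
  \<open>V (s * (d + 1))\<close> on for a forward difference quotient. At multiples of \<open>n\<close> it restarts.\<close>

definition fd_gradient :: "(nat \<Rightarrow> real) \<Rightarrow> nat \<Rightarrow> nat \<Rightarrow> real" where
  "fd_gradient V s = (\<lambda>i. if i < d then (V (s * (d + 1) + Suc i) - V (s * (d + 1))) / h else 0)"

definition step_size :: "nat \<Rightarrow> real" where
  "step_size s = 2 / (real (s mod n) + 2)"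

text \<open>At the start of an epoch the second sequence of the pair is reset to the first; this is
  the restart.\<close>

definition prox_center :: "(nat \<Rightarrow> real) \<times> (nat \<Rightarrow> real) \<Rightarrow> nat \<Rightarrow> nat \<Rightarrow> real" where
  "prox_center p s = (if s mod n = 0 then fst p else snd p)"

primrec iterate :: "(nat \<Rightarrow> real) \<Rightarrow> nat \<Rightarrow> (nat \<Rightarrow> real) \<times> (nat \<Rightarrow> real)" where
  "iterate V 0 = (\<lambda>_. 0, \<lambda>_. 0)"
| "iterate V (Suc s) =
    (let z = prox_point d r \<beta> (step_size s) (fd_gradient V s) (prox_center (iterate V s) s)
     in (lincomb (step_size s) (fst (iterate V s)) z, z))"

definition base_point :: "(nat \<Rightarrow> real) \<Rightarrow> nat \<Rightarrow> nat \<Rightarrow> real" where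
  "base_point V s = lincomb (step_size s) (fst (iterate V s)) (prox_center (iterate V s) s)"

text \<open>Step \<open>t div (d + 1)\<close> asks first for its base point (remainder 0), then for
  the shift by \<open>h\<close> along coordinate \<open>i\<close> (remainder
  \<open>Suc i\<close>).\<close>

definition query_point :: "(nat \<Rightarrow> real) \<Rightarrow> nat \<Rightarrow> nat \<Rightarrow> real" where
  "query_point V t =
     (\<lambda>i. base_point V (t div (d + 1)) i + (if t mod (d + 1) = Suc i then h else 0))"

lemma iterate_cong:
  assumes "\<And>j. j < s * (d + 1) \<Longrightarrow> V j = W j"
  shows "iterate V s = iterate W s"
  using assms
proof (induction s)
  case (Suc s)
  then have "iterate V s = iterate W s" "fd_gradient V s = fd_gradient W s"
    by (auto simp: fd_gradient_def)
  then show ?case by simp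
qed simp

text \<open>Non-anticipation: query \<open>t\<close> depends only on earlier answers, so it can be
  computed from a transcript of length \<open>t\<close>.\<close>

lemma query_point_cong:
  assumes "\<And>j. j < t \<Longrightarrow> V j = W j"
  shows "query_point V t = query_point W t"
proof -
  have "t div (d + 1) * (d + 1) \<le> t" by (rule div_times_less_eq_dividend)
  then have "iterate V (t div (d + 1)) = iterate W (t div (d + 1))"
    using assms by (intro iterate_cong) simp
  then show ?thesis by (simp add: query_point_def base_point_def)
qed

lemma step_size_bounds: "0 < step_size s" "step_size s \<le> 1"
  by (auto simp: step_size_def)

lemma fd_gradient_Rn: "fd_gradient V s \<in> Rn d"
  by (simp add: fd_gradient_def Rn_iff)

lemma iterate_in_ball2:
  assumes "0 < r"
  shows "fst (iterate V s) \<in> ball2 d r \<and> snd (iterate V s) \<in> ball2 d r"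
proof (induction s)
  case 0
  then show ?case using assms by (simp add: ball2_def Rn_iff norm_Rn_def L2_set_def)
next
  case (Suc s)
  then have "prox_center (iterate V s) s \<in> Rn d" by (auto simp: prox_center_def ball2_def)
  then have "prox_point d r \<beta> (step_size s) (fd_gradient V s) (prox_center (iterate V s) s) \<in> ball2 d r"
    unfolding prox_point_def using fd_gradient_Rn[of V s]
    by (intro ball_proj_in_ball2 assms) (simp add: Rn_iff)
  with Suc show ?case using step_size_bounds[of s]
    by (auto simp: Let_def intro!: lincomb_in_ball2)
qed

lemma prox_center_in_ball2: "0 < r \<Longrightarrow> prox_center (iterate V s) s \<in> ball2 d r"
  using iterate_in_ball2[of V s] by (simp add: prox_center_def)

lemma base_point_in_ball2: "0 < r \<Longrightarrow> base_point V s \<in> ball2 d r"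
  unfolding base_point_def using iterate_in_ball2[of V s] prox_center_in_ball2[of V s]
    step_size_bounds[of s] by (intro lincomb_in_ball2) auto

lemma inner_Rn_unit_vector:
  assumes "j < d"
  shows "inner_Rn d x (\<lambda>i. if i = j then h else 0) = h * x j"
proof -
  have "inner_Rn d x (\<lambda>i. if i = j then h else 0) = (\<Sum>i<d. if i = j then x i * h else 0)"
    unfolding inner_Rn_def by (rule sum.cong) auto
  then show ?thesis using assms by simp
qed

lemma norm_Rn_unit_vector_le:
  assumes "0 \<le> h"
  shows "norm_Rn d (\<lambda>i. if c = Suc i then h else 0) \<le> h"
proof (cases "\<exists>j<d. c = Suc j")
  case True
  then obtain j where j: "j < d" "c = Suc j" by blast
  have "(\<lambda>i. if c = Suc i then h else 0) = (\<lambda>i. if i = j then h else 0)" using j by auto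
  then show ?thesis
    using assms j inner_Rn_unit_vector[OF j(1), of "\<lambda>i. if i = j then h else 0"]
    by (simp add: norm_Rn_le_iff power2_eq_square)
next
  case False
  then have "norm_Rn d (\<lambda>i. if c = Suc i then h else 0) = 0"
    by (auto simp: norm_Rn_def L2_set_eq_0_iff)
  then show ?thesis using assms by simp
qed

text \<open>Base points stay in the ball of radius \<open>r\<close>; difference quotients leave it
  by at most \<open>h\<close>.\<close>

lemma query_point_in_ball2:
  assumes "0 < r" "0 \<le> h"
  shows "query_point V t \<in> ball2 d (r + h)"
proof -
  let ?c = "t mod (d + 1)" and ?y = "base_point V (t div (d + 1))"
  have y: "?y \<in> ball2 d r" by (rule base_point_in_ball2[OF assms(1)])
  have "?c \<le> d" using mod_less_divisor[of "d + 1" t] by linarith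
  then have "?c \<noteq> Suc i" if "d \<le> i" for i using that by linarith
  then have "query_point V t \<in> Rn d"
    using y by (simp add: ball2_def Rn_iff query_point_def)
  moreover have "norm_Rn d (query_point V t) \<le> r + h"
    unfolding query_point_def
    using norm_Rn_add[of d ?y "\<lambda>i. if ?c = Suc i then h else 0"]
      norm_Rn_unit_vector_le[OF assms(2), of ?c] y
    by (simp add: ball2_def)
  ultimately show ?thesis by (simp add: ball2_def)
qed

text \<open>The second-order error \<beta> h^2 divided by \<open>h\<close> bounds each coordinate;
  the Euclidean norm is at most the sum over the \<open>d\<close> coordinates.\<close>

lemma fd_gradient_error:
  assumes f: "smooth_strongly_convex d \<mu> \<beta> f G" and "0 \<le> \<mu>" "0 < r" "0 < h"
    and V: "\<And>t. V t = f (query_point V t)"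
  shows "norm_Rn d (G (base_point V s) - fd_gradient V s) \<le> real d * (\<beta> * h)"
proof -
  let ?y = "base_point V s"
  have y: "?y \<in> Rn d" using base_point_in_ball2[OF \<open>0 < r\<close>, of V s] by (simp add: ball2_def)
  have "\<bar>(G ?y - fd_gradient V s) i\<bar> \<le> \<beta> * h" if i: "i < d" for i
  proof -
    let ?e = "\<lambda>j. if j = i then h else 0"
    have "(s * (d + 1) + Suc i) div (d + 1) = s" "(s * (d + 1) + Suc i) mod (d + 1) = Suc i"
      using i by (simp_all only: div_mult_self3 mod_mult_self3 div_less mod_less)
    then have "query_point V (s * (d + 1) + Suc i) = (\<lambda>j. ?y j + ?e j)"
      by (auto simp: query_point_def)
    moreover have "query_point V (s * (d + 1)) = ?y"
      by (simp add: query_point_def del: mult_Suc_right)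
    ultimately have g: "fd_gradient V s i = (f (\<lambda>j. ?y j + ?e j) - f ?y) / h"
      using i V by (metis fd_gradient_def)
    have yR: "(\<lambda>j. ?y j + ?e j) \<in> Rn d" using y i by (auto simp: Rn_iff)
    have e: "(\<lambda>j. ?y j + ?e j) - ?y = ?e" by auto
    have ne: "(norm_Rn d ?e)\<^sup>2 = h\<^sup>2"
      unfolding norm_Rn_power2 inner_Rn_unit_vector[OF i] by (simp add: power2_eq_square)
    have "\<bar>f (\<lambda>j. ?y j + ?e j) - f ?y - h * G ?y i\<bar> \<le> \<beta> * h\<^sup>2"
      using smooth_strongly_convex_error[OF f \<open>0 \<le> \<mu>\<close> y yR]
      unfolding e ne inner_Rn_unit_vector[OF i] .
    moreover have "f (\<lambda>j. ?y j + ?e j) - f ?y - h * G ?y i = h * (fd_gradient V s i - G ?y i)"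
      unfolding g using \<open>0 < h\<close> by (simp add: field_simps)
    ultimately have "h * \<bar>fd_gradient V s i - G ?y i\<bar> \<le> h * (\<beta> * h)"
      using \<open>0 < h\<close> by (simp add: abs_mult power2_eq_square mult_ac)
    then show ?thesis using \<open>0 < h\<close> by (simp add: abs_minus_commute)
  qed
  then have "(\<Sum>i<d. \<bar>(G ?y - fd_gradient V s) i\<bar>) \<le> (\<Sum>i<d. \<beta> * h)" by (intro sum_mono) auto
  then show ?thesis
    using L2_set_le_sum_abs[of "G ?y - fd_gradient V s" "{..<d}"]
    by (simp add: norm_Rn_def del: minus_apply)
qed

text \<open>The potential inequality summed over one epoch. Initially only the squared distance to
  \<open>u\<close> counts; at the end the distance term is dropped and the weight n(n+2)/4 divided
  out.\<close>

lemma iterate_epoch: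
  assumes f: "smooth_strongly_convex d \<mu> \<beta> f G" and "0 \<le> \<mu>" "0 < \<beta>" "0 < r" "0 < n"
    and u: "u \<in> ball2 d r" and min: "\<And>y. y \<in> Rn d \<Longrightarrow> f u \<le> f y"
    and \<eta>: "\<And>s. norm_Rn d (G (base_point V s) - fd_gradient V s) \<le> \<eta>"
  shows "f (fst (iterate V (Suc e * n))) - f u
    \<le> 4 * \<beta> / (real n * (real n + 2)) * (norm_Rn d (fst (iterate V (e * n)) - u))\<^sup>2 + 4 * r * \<eta>"
proof -
  define x where "x s = fst (iterate V s)" for s
  define z where "z s = snd (iterate V s)" for s
  \<comment> \<open>The prox centre at position \<open>t\<close> of the epoch, with the reset at
    \<open>t = 0\<close>.\<close>
  define c where "c t = (if t = 0 then x (e * n) else z (e * n + t))" for t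
  define \<rho> where "\<rho> = (norm_Rn d (x (e * n) - u))\<^sup>2"
  have \<eta>0: "0 \<le> \<eta>" using \<eta>[of 0] norm_Rn_nonneg order_trans by blast
  have xb: "x s \<in> ball2 d r" for s using iterate_in_ball2[OF \<open>0 < r\<close>] by (simp add: x_def)
  have pot: "real t * (real t + 2) / 4 * (f (x (e * n + t)) - f u) + \<beta> * (norm_Rn d (c t - u))\<^sup>2
      \<le> \<beta> * \<rho> + r * \<eta> * (real t * (real t + 2))" if "t \<le> n" for t
    using that
  proof (induction t)
    case 0
    show ?case by (simp add: c_def \<rho>_def fun_diff_def)
  next
    case (Suc t)
    let ?s = "e * n + t"
    have "t < n" using Suc.prems by simp
    then have mod: "?s mod n = t" by (metis mod_less mod_mult_self3)
    have th: "step_size ?s = 2 / (real t + 2)" by (simp only: step_size_def mod)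
    have ct: "prox_center (iterate V ?s) ?s = c t"
      unfolding prox_center_def mod by (simp add: c_def x_def z_def)
    have zS: "z (Suc ?s) = prox_point d r \<beta> (2 / (real t + 2)) (fd_gradient V ?s) (c t)"
      by (simp add: z_def Let_def th ct)
    have xS: "x (Suc ?s) = lincomb (2 / (real t + 2)) (x ?s) (z (Suc ?s))"
      by (simp add: x_def z_def Let_def th)
    have base: "base_point V ?s = lincomb (2 / (real t + 2)) (x ?s) (c t)"
      by (simp add: base_point_def th ct x_def)
    have cb: "c t \<in> ball2 d r" using prox_center_in_ball2[OF \<open>0 < r\<close>, of V ?s] by (simp only: ct)
    have "real (Suc t) * (real (Suc t) + 2) / 4 * (f (x (Suc ?s)) - f u)
        + \<beta> * (norm_Rn d (z (Suc ?s) - u))\<^sup>2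
      \<le> real t * (real t + 2) / 4 * (f (x ?s) - f u) + \<beta> * (norm_Rn d (c t - u))\<^sup>2
        + r * \<eta> * (real t + 2)"
      by (rule accelerated_potential_step[OF f \<open>0 \<le> \<mu>\<close> \<open>0 < \<beta>\<close> \<open>0 < r\<close> xb cb u min refl
            fd_gradient_Rn[of V ?s] \<eta>[of ?s, unfolded base] zS xS])
         (use xb in \<open>simp_all add: ball2_def\<close>)
    also have "\<dots> \<le> \<beta> * \<rho> + r * \<eta> * (real t * (real t + 2)) + r * \<eta> * (real t + 2)"
      using Suc.IH[OF Suc_leD[OF Suc.prems]] by linarith
    also have "\<dots> = \<beta> * \<rho> + r * \<eta> * ((real t + 1) * (real t + 2))" by (simp add: algebra_simps)
    also have "\<dots> \<le> \<beta> * \<rho> + r * \<eta> * (real (Suc t) * (real (Suc t) + 2))"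
      using \<eta>0 \<open>0 < r\<close> by (intro add_left_mono mult_left_mono mult_mono) auto
    finally show ?case by (simp add: c_def fun_diff_def)
  qed
  define A where "A = real n * (real n + 2) / 4"
  have A: "0 < A" using \<open>0 < n\<close> by (simp add: A_def)
  have "A * (f (x (e * n + n)) - f u) \<le> \<beta> * \<rho> + r * \<eta> * (4 * A)"
  proof -
    have "0 \<le> \<beta> * (norm_Rn d (c n - u))\<^sup>2" using \<open>0 < \<beta>\<close> by simp
    moreover have "r * \<eta> * (real n * (real n + 2)) = r * \<eta> * (4 * A)" by (simp add: A_def)
    ultimately show ?thesis using pot[of n, folded A_def] by linarith
  qed
  also have "\<dots> = A * (\<beta> / A * \<rho> + 4 * r * \<eta>)" using A by (simp add: field_simps)
  finally have "f (x (e * n + n)) - f u \<le> \<beta> / A * \<rho> + 4 * r * \<eta>"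
    using A by (simp only: mult_le_cancel_left_pos)
  then show ?thesis by (simp add: A_def x_def \<rho>_def add.commute mult.commute)
qed

text \<open>The length of an epoch makes the factor in \<open>iterate_epoch\<close> at most
  \<mu>/16. Growth turns the function gap back into squared distance, which is thereby divided by
  four up to the gradient error.\<close>

lemma iterate_restarted:
  assumes f: "smooth_strongly_convex d \<mu> \<beta> f G" and "0 < \<mu>" "0 < \<beta>" "0 < r"
    and n: "0 < n" "64 * \<beta> \<le> \<mu> * (real n)\<^sup>2"
    and u: "u \<in> ball2 d r" and min: "\<And>y. y \<in> Rn d \<Longrightarrow> f u \<le> f y"
    and \<eta>: "\<And>s. norm_Rn d (G (base_point V s) - fd_gradient V s) \<le> \<eta>"
  shows "f (fst (iterate V (Suc e * n))) - f u \<le> \<mu> / 4 * ((1 / 4) ^ Suc e * r\<^sup>2) + 8 * r * \<eta>"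
proof -
  \<comment> \<open>The error of one epoch in units of squared distance. The accumulated error stays
    below \<open>2 * \<zeta>\<close>, because \<open>2 * \<zeta> / 4 + \<zeta>\<close> does.\<close>
  define \<zeta> where "\<zeta> = 16 * r * \<eta> / \<mu>"
  have \<eta>0: "0 \<le> \<eta>" using \<eta>[of 0] norm_Rn_nonneg order_trans by blast
  have \<zeta>: "0 \<le> \<zeta>" "\<mu> / 4 * \<zeta> = 4 * r * \<eta>" using assms \<eta>0 by (auto simp: \<zeta>_def)
  have step: "f (fst (iterate V (Suc e * n))) - f u \<le> \<mu> / 4 * (b / 4 + \<zeta>)"
    if "(norm_Rn d (fst (iterate V (e * n)) - u))\<^sup>2 \<le> b" for e b
  proof -
    have "4 * \<beta> / (real n * (real n + 2)) \<le> 4 * \<beta> / (real n)\<^sup>2"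
      using n \<open>0 < \<beta>\<close> by (intro divide_left_mono) (auto simp: power2_eq_square)
    also have "\<dots> \<le> \<mu> / 16" using n by (simp add: field_simps)
    finally have "4 * \<beta> / (real n * (real n + 2)) * (norm_Rn d (fst (iterate V (e * n)) - u))\<^sup>2
        \<le> \<mu> / 16 * b"
      using that \<open>0 < \<mu>\<close> by (intro mult_mono) auto
    then have "f (fst (iterate V (Suc e * n))) - f u \<le> \<mu> / 16 * b + 4 * r * \<eta>"
      using iterate_epoch[OF f less_imp_le[OF \<open>0 < \<mu>\<close>] \<open>0 < \<beta>\<close> \<open>0 < r\<close> n(1) u min \<eta>, of e]
      by linarith
    also have "\<dots> = \<mu> / 4 * (b / 4 + \<zeta>)" unfolding distrib_left \<zeta>(2) by simp
    finally show ?thesis .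
  qed
  have dist: "(norm_Rn d (fst (iterate V (e * n)) - u))\<^sup>2 \<le> (1 / 4) ^ e * r\<^sup>2 + 2 * \<zeta>" for e
  proof (induction e)
    case 0
    have "norm_Rn d ((\<lambda>_. 0) - u) = norm_Rn d u" by (simp add: norm_Rn_def L2_set_def)
    moreover have "(norm_Rn d u)\<^sup>2 \<le> r\<^sup>2" using u by (intro power_mono) (auto simp: ball2_def)
    ultimately have "(norm_Rn d ((\<lambda>_. 0) - u))\<^sup>2 \<le> r\<^sup>2" by (simp only:)
    then show ?case using \<zeta>(1) by (simp add: fun_diff_def)
  next
    case (Suc e)
    let ?x = "fst (iterate V (Suc e * n))"
    have "?x \<in> Rn d" "u \<in> Rn d"
      using iterate_in_ball2[OF \<open>0 < r\<close>] u by (auto simp: ball2_def)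
    then have "\<mu> / 4 * (norm_Rn d (?x - u))\<^sup>2 \<le> f ?x - f u"
      using smooth_strongly_convex_growth[OF f _ _ min] by (simp add: le_diff_eq add.commute)
    also have "\<dots> \<le> \<mu> / 4 * (((1 / 4) ^ e * r\<^sup>2 + 2 * \<zeta>) / 4 + \<zeta>)" by (rule step[OF Suc])
    finally have "(norm_Rn d (?x - u))\<^sup>2 \<le> ((1 / 4) ^ e * r\<^sup>2 + 2 * \<zeta>) / 4 + \<zeta>"
      using \<open>0 < \<mu>\<close> by simp
    also have "\<dots> \<le> (1 / 4) ^ Suc e * r\<^sup>2 + 2 * \<zeta>" using \<zeta>(1) by simp
    finally show ?case .
  qed
  have "f (fst (iterate V (Suc e * n))) - f u \<le> \<mu> / 4 * (((1 / 4) ^ e * r\<^sup>2 + 2 * \<zeta>) / 4 + \<zeta>)"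
    by (rule step[OF dist])
  also have "\<dots> \<le> \<mu> / 4 * ((1 / 4) ^ Suc e * r\<^sup>2 + 2 * \<zeta>)"
    using \<open>0 < \<mu>\<close> \<zeta>(1) by (intro mult_left_mono) auto
  also have "\<dots> = \<mu> / 4 * ((1 / 4) ^ Suc e * r\<^sup>2) + 8 * r * \<eta>"
    using \<zeta>(2) by (simp add: algebra_simps)
  finally show ?thesis .
qed

end

section \<open>Borel measurability of the algorithm\<close>

lemma borel_measurable_norm_Rn:
  assumes "\<And>i. (\<lambda>\<omega>. x \<omega> i) \<in> borel_measurable M"
  shows "(\<lambda>\<omega>. norm_Rn d (x \<omega>)) \<in> borel_measurable M"
  unfolding norm_Rn_def L2_set_def using assms by measurable

lemma borel_measurable_iterate:
  assumes "\<And>j. j < s * (d + 1) \<Longrightarrow> (\<lambda>\<omega>. V \<omega> j) \<in> borel_measurable M"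
  shows "(\<lambda>\<omega>. fst (iterate d r \<beta> h n (V \<omega>) s) i) \<in> borel_measurable M
    \<and> (\<lambda>\<omega>. snd (iterate d r \<beta> h n (V \<omega>) s) i) \<in> borel_measurable M"
  using assms
proof (induction s arbitrary: i)
  case 0
  show ?case by simp
next
  case (Suc s)
  have IH: "(\<lambda>\<omega>. fst (iterate d r \<beta> h n (V \<omega>) s) i) \<in> borel_measurable M"
    "(\<lambda>\<omega>. snd (iterate d r \<beta> h n (V \<omega>) s) i) \<in> borel_measurable M" for i
    using Suc.IH Suc.prems by auto
  have g: "(\<lambda>\<omega>. fd_gradient d h (V \<omega>) s i) \<in> borel_measurable M" for i
  proof (cases "i < d")
    case True
    then have "(\<lambda>\<omega>. V \<omega> (s * (d + 1) + Suc i)) \<in> borel_measurable M"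
      "(\<lambda>\<omega>. V \<omega> (s * (d + 1))) \<in> borel_measurable M"
      by (auto intro!: Suc.prems)
    then show ?thesis unfolding fd_gradient_def using True by simp
  qed (simp add: fd_gradient_def)
  have c: "(\<lambda>\<omega>. prox_center n (iterate d r \<beta> h n (V \<omega>) s) s i) \<in> borel_measurable M" for i
    using IH by (cases "s mod n = 0") (simp_all add: prox_center_def)
  define w where "w \<omega> = (\<lambda>i. prox_center n (iterate d r \<beta> h n (V \<omega>) s) s i
      - 1 / (2 * \<beta> * step_size n s) * fd_gradient d h (V \<omega>) s i)" for \<omega>
  have w: "(\<lambda>\<omega>. w \<omega> i) \<in> borel_measurable M" for i
    unfolding w_def using c g by measurable
  have z: "(\<lambda>\<omega>. ball_proj d r (w \<omega>) i) \<in> borel_measurable M" for i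
    unfolding ball_proj_def using w borel_measurable_norm_Rn[OF w] by measurable
  have x: "(\<lambda>\<omega>. lincomb (step_size n s) (fst (iterate d r \<beta> h n (V \<omega>) s)) (ball_proj d r (w \<omega>)) i)
      \<in> borel_measurable M"
    unfolding lincomb_def using IH z by measurable
  show ?case using x z by (simp add: Let_def prox_point_def w_def)
qed

lemma borel_measurable_query_point:
  assumes "\<And>j. j < t \<Longrightarrow> (\<lambda>\<omega>. V \<omega> j) \<in> borel_measurable M"
  shows "(\<lambda>\<omega>. query_point d r \<beta> h n (V \<omega>) t i) \<in> borel_measurable M"
proof -
  let ?s = "t div (d + 1)"
  have "?s * (d + 1) \<le> t" by (rule div_times_less_eq_dividend)
  then have it: "(\<lambda>\<omega>. fst (iterate d r \<beta> h n (V \<omega>) ?s) i) \<in> borel_measurable M"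
    "(\<lambda>\<omega>. snd (iterate d r \<beta> h n (V \<omega>) ?s) i) \<in> borel_measurable M"
    using borel_measurable_iterate[of ?s d V M] assms by auto
  show ?thesis
    unfolding query_point_def base_point_def lincomb_def prox_center_def
    using it by (cases "?s mod n = 0"; simp)
qed

text \<open>The Borel sets are traces of those of the product topology, so measurability is checked
  coordinate by coordinate.\<close>

lemma measurable_query_spaceI:
  assumes "\<And>i. (\<lambda>\<omega>. x \<omega> i) \<in> borel_measurable M" "\<And>\<omega>. x \<omega> \<in> ball2 d R"
  shows "x \<in> M \<rightarrow>\<^sub>M query_space d R"
  unfolding query_space_def
  by (rule measurable_restrict_space2)
     (use assms in \<open>auto intro: measurable_coordinatewise_then_product\<close>)

lemma measurable_transcript_value:
  assumes "j < t"
  shows "(\<lambda>\<omega>. snd (\<omega> j)) \<in> borel_measurable (transcript_space d R t)"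
  unfolding transcript_space_def
  by (rule measurable_compose[where N = "query_space d R \<Otimes>\<^sub>M borel"])
     (use assms in \<open>auto intro: measurable_component_singleton\<close>)

section \<open>Parameters and cost of the algorithm\<close>

lemma run_apply:
  "j < t \<Longrightarrow> run Q f t j = (Q j (run Q f j), f (Q j (run Q f j)))"
  by (induction t) (auto simp: Let_def less_Suc_eq)

lemma upper_bound:
  assumes "0 < R" "0 < \<mu>" "\<mu> \<le> \<beta>" and \<kappa>: "\<kappa> = \<beta> / \<mu>" and d: "1 \<le> d"
    and \<epsilon>: "0 < \<epsilon>" "\<epsilon> \<le> \<mu> * R\<^sup>2"
  obtains T Q Qout where "algorithm d R T Q Qout"
    "\<And>f. f \<in> obj_class d R \<mu> \<beta> \<Longrightarrow> f (Qout (run Q f T)) - min_value d f \<le> \<epsilon>"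
    "real T \<le> 36 * real d * sqrt \<kappa> * (1 + ln (\<mu> * R\<^sup>2 / \<epsilon>))"
proof -
  have \<beta>: "0 < \<beta>" using assms by simp
  define L where "L = ln (\<mu> * R\<^sup>2 / \<epsilon>)"
  have q: "1 \<le> \<mu> * R\<^sup>2 / \<epsilon>" using \<epsilon> by simp
  have L: "0 \<le> L" using q by (simp add: L_def)
  define e where "e = nat \<lceil>L\<rceil>"
  have e: "L \<le> real e" "real e \<le> L + 1" using L by (auto simp: e_def)
  define n where "n = nat \<lceil>8 * sqrt \<kappa>\<rceil>"
  have \<kappa>1: "1 \<le> \<kappa>" using assms by simp
  have sq1: "1 \<le> sqrt \<kappa>" using \<kappa>1 by simp
  have n: "8 * sqrt \<kappa> \<le> real n" "real n \<le> 9 * sqrt \<kappa>" using sq1 unfolding n_def by linarith+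
  have n0: "0 < n" using n sq1 by (cases n) auto
  have "(8 * sqrt \<kappa>)\<^sup>2 \<le> (real n)\<^sup>2" using n sq1 by (intro power_mono) auto
  then have "\<mu> * (64 * \<kappa>) \<le> \<mu> * (real n)\<^sup>2"
    using \<open>0 < \<mu>\<close> \<kappa>1 by (intro mult_left_mono) (auto simp: power_mult_distrib)
  then have n2: "64 * \<beta> \<le> \<mu> * (real n)\<^sup>2" using \<open>0 < \<mu>\<close> by (simp add: \<kappa>)
  \<comment> \<open>With r = R/2 the error term \<open>8 * r * \<eta>\<close> of
    \<open>iterate_restarted\<close> is half of \<epsilon>.\<close>
  define \<eta> where "\<eta> = \<epsilon> / (8 * R)"
  \<comment> \<open>The first bound keeps the shifted queries in the ball of radius R, the second
    keeps the gradient error below \<eta>.\<close>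
  define h where "h = min (R / 2) (\<eta> / (real d * \<beta>))"
  have h: "0 < h" "h \<le> R / 2" using assms \<beta> by (auto simp: h_def \<eta>_def)
  have "h \<le> \<eta> / (real d * \<beta>)" by (simp add: h_def)
  then have h\<eta>: "real d * (\<beta> * h) \<le> \<eta>" using d \<beta> by (simp add: field_simps)
  \<comment> \<open>This ball contains every admissible minimiser and leaves room R/2 for the
    shifts.\<close>
  define r where "r = R / 2"
  have r: "0 < r" using \<open>0 < R\<close> by (simp add: r_def)
  define N where "N = Suc e * n"
  define T where "T = N * (d + 1)"
  define Q :: "nat \<Rightarrow> transcript \<Rightarrow> nat \<Rightarrow> real"
    where "Q t \<omega> = query_point d r \<beta> h n (\<lambda>j. snd (\<omega> j)) t" for t \<omega>
  define Qout :: "transcript \<Rightarrow> nat \<Rightarrow> real"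
    where "Qout \<omega> = fst (iterate d r \<beta> h n (\<lambda>j. snd (\<omega> j)) N)" for \<omega>
  have mono: "x \<in> ball2 d R" if "x \<in> ball2 d \<rho>" "\<rho> \<le> R" for x \<rho>
    using that by (auto simp: ball2_def)
  have "algorithm d R T Q Qout"
    unfolding algorithm_def
  proof (intro conjI allI impI)
    show "Q t \<in> transcript_space d R t \<rightarrow>\<^sub>M query_space d R" for t
      unfolding Q_def
    proof (rule measurable_query_spaceI)
      show "query_point d r \<beta> h n (\<lambda>j. snd (\<omega> j)) t \<in> ball2 d R" for \<omega> :: transcript
        using mono[OF query_point_in_ball2[OF r less_imp_le[OF h(1)]]] h by (simp add: r_def)
    qed (intro borel_measurable_query_point measurable_transcript_value)
    show "Qout \<in> transcript_space d R T \<rightarrow>\<^sub>M query_space d R"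
      unfolding Qout_def
    proof (rule measurable_query_spaceI)
      show "fst (iterate d r \<beta> h n (\<lambda>j. snd (\<omega> j)) N) \<in> ball2 d R" for \<omega> :: transcript
        using iterate_in_ball2[OF r, of d \<beta> h n "\<lambda>j. snd (\<omega> j)" N] mono[of _ r] \<open>0 < R\<close>
        by (simp add: r_def)
      show "(\<lambda>\<omega>. fst (iterate d r \<beta> h n (\<lambda>j. snd (\<omega> j)) N) i)
          \<in> borel_measurable (transcript_space d R T)" for i
        by (rule conjunct1[OF borel_measurable_iterate])
           (simp add: measurable_transcript_value T_def)
    qed
  qed
  moreover have "f (Qout (run Q f T)) - min_value d f \<le> \<epsilon>" if f: "f \<in> obj_class d R \<mu> \<beta>" for f
  proof -
    obtain G u where G: "smooth_strongly_convex d \<mu> \<beta> f G" and u: "u \<in> ball2 d (R / 2)"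
      and min: "\<And>y. y \<in> Rn d \<Longrightarrow> f u \<le> f y" and fu: "min_value d f = f u"
      using obj_classE[OF f] by metis
    \<comment> \<open>The answers of the actual run. By non-anticipation they solve
      \<open>V t = f (query_point V t)\<close>, so the analysis applies to a single infinite
      sequence in place of growing transcripts.\<close>
    define V where "V j = f (Q j (run Q f j))" for j
    have V: "snd (run Q f t j) = V j" if "j < t" for t j
      using run_apply[OF that] by (simp add: V_def)
    have "query_point d r \<beta> h n (\<lambda>j. snd (run Q f t j)) t = query_point d r \<beta> h n V t" for t
      by (rule query_point_cong) (rule V)
    then have "Q t (run Q f t) = query_point d r \<beta> h n V t" for t
      by (simp only: Q_def[of t "run Q f t"])
    then have Vq: "V t = f (query_point d r \<beta> h n V t)" for t by (simp add: V_def)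
    have out: "Qout (run Q f T) = fst (iterate d r \<beta> h n V N)"
      unfolding Qout_def
      by (rule arg_cong[where f = fst], rule iterate_cong) (rule V, simp add: T_def)
    have grad: "norm_Rn d (G (base_point d r \<beta> h n V s) - fd_gradient d h V s) \<le> \<eta>" for s
      using fd_gradient_error[OF G less_imp_le[OF \<open>0 < \<mu>\<close>] r h(1) Vq, of s] h\<eta> by linarith
    have "f (Qout (run Q f T)) - f u \<le> \<mu> / 4 * ((1 / 4) ^ Suc e * r\<^sup>2) + 8 * r * \<eta>"
      unfolding out N_def
      by (rule iterate_restarted[OF G \<open>0 < \<mu>\<close> \<beta> r n0 n2 _ min grad]) (use u in \<open>simp_all add: r_def\<close>)
    also have "8 * r * \<eta> = \<epsilon> / 2" using \<open>0 < R\<close> by (simp add: r_def \<eta>_def)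
    \<comment> \<open>Each epoch gains a factor 4, more than exp 1, so \<open>e\<close> at least
      ln(\<mu>R^2/\<epsilon>) suffices.\<close>
    also have "\<mu> / 4 * ((1 / 4) ^ Suc e * r\<^sup>2) \<le> \<epsilon> / 2"
    proof -
      have "\<mu> * R\<^sup>2 / \<epsilon> = exp L" using q by (simp add: L_def)
      also have "\<dots> \<le> exp (real e)" using e by simp
      also have "\<dots> = exp 1 ^ e" by (simp flip: exp_of_nat_mult)
      also have "\<dots> \<le> 4 ^ e" using exp_le by (intro power_mono) auto
      also have "\<dots> \<le> 4 ^ Suc e" by simp
      finally have "\<mu> * R\<^sup>2 \<le> \<epsilon> * 4 ^ Suc e" using \<epsilon> by (simp add: field_simps)
      then have "\<mu> * R\<^sup>2 * (1 / 4) ^ Suc e \<le> \<epsilon>" by (simp add: field_simps power_one_over)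
      then show ?thesis using \<epsilon>(1) by (simp add: r_def power_divide mult_ac)
    qed
    finally show ?thesis by (simp add: fu)
  qed
  moreover have "real T \<le> 36 * real d * sqrt \<kappa> * (1 + ln (\<mu> * R\<^sup>2 / \<epsilon>))"
  proof -
    \<comment> \<open>\<open>Suc e\<close> epochs of \<open>n\<close> steps with
      \<open>d + 1\<close> queries each; the factors 2, 9 and 2 multiply to 36.\<close>
    have "real T = (real e + 1) * real n * (real d + 1)" by (simp add: T_def N_def algebra_simps)
    also have "\<dots> \<le> (2 * (1 + L)) * (9 * sqrt \<kappa>) * (2 * real d)"
      using e n d L sq1 by (intro mult_mono) auto
    finally show ?thesis by (simp add: L_def mult_ac)
  qed
  ultimately show ?thesis by (rule that)
qed

section \<open>The two-sided bound\<close>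

theorem corollary3p9:
  shows "\<exists>(c::real) (C::real) (c_eps::real) (d0::nat). 0 < c \<and> 0 < C \<and> 0 < c_eps \<and>
    (\<forall>(d::nat) (R::real) (\<mu>::real) (\<beta>::real) (\<epsilon>::real) (\<kappa>::real).
       d0 \<le> d \<longrightarrow> 0 < R \<longrightarrow> 0 < \<mu> \<longrightarrow> \<mu> \<le> \<beta> \<longrightarrow> \<kappa> = \<beta> / \<mu> \<longrightarrow>
       \<kappa> \<le> (real d / ln (exp 1 * real d)) powr (2 / 3) \<longrightarrow>
       0 < \<epsilon> \<longrightarrow> \<epsilon> \<le> c_eps * \<mu> * R\<^sup>2 \<longrightarrow>
       ereal (c * real d * sqrt \<kappa>) \<le> ereal_of_enat (exact_value_complexity d R \<mu> \<beta> \<epsilon>) \<and>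
       ereal_of_enat (exact_value_complexity d R \<mu> \<beta> \<epsilon>)
         \<le> ereal (C * real d * sqrt \<kappa> * (1 + ln (\<mu> * R\<^sup>2 / \<epsilon>))))"
\<comment> \<open>1/1024, 1/256 and 8 are the constants of \<open>lower_bound\<close>; 36 is that of
  \<open>upper_bound\<close>.\<close>
proof (rule exI[of _ "1 / 1024"], rule exI[of _ 36], rule exI[of _ "1 / 256"], rule exI[of _ 8],
    intro conjI allI impI)
  fix d :: nat and R \<mu> \<beta> \<epsilon> \<kappa> :: real
  assume d: "8 \<le> d" and R: "0 < R" and \<mu>: "0 < \<mu>" "\<mu> \<le> \<beta>" and \<kappa>: "\<kappa> = \<beta> / \<mu>"
    and \<kappa>_le: "\<kappa> \<le> (real d / ln (exp 1 * real d)) powr (2 / 3)"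
    and \<epsilon>: "0 < \<epsilon>" "\<epsilon> \<le> 1 / 256 * \<mu> * R\<^sup>2"
  define A where "A = {enat T | T. \<exists>Q Qout. algorithm d R T Q Qout \<and>
       (SUP f\<in>obj_class d R \<mu> \<beta>. ereal (f (Qout (run Q f T)) - min_value d f)) \<le> ereal \<epsilon>}"
  have N: "exact_value_complexity d R \<mu> \<beta> \<epsilon> = Inf A"
    by (simp add: exact_value_complexity_def A_def)
  have "0 \<le> \<mu> * R\<^sup>2" using \<mu> by simp
  then have \<epsilon>': "\<epsilon> \<le> \<mu> * R\<^sup>2" using \<epsilon>(2) by linarith
  obtain T Q Qout where T: "algorithm d R T Q Qout"
    "\<And>f. f \<in> obj_class d R \<mu> \<beta> \<Longrightarrow> f (Qout (run Q f T)) - min_value d f \<le> \<epsilon>"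
    "real T \<le> 36 * real d * sqrt \<kappa> * (1 + ln (\<mu> * R\<^sup>2 / \<epsilon>))"
    using upper_bound[OF R \<mu> \<kappa> _ \<epsilon>(1) \<epsilon>'] d by (metis le_trans numeral_One one_le_numeral)
  have "(SUP f\<in>obj_class d R \<mu> \<beta>. ereal (f (Qout (run Q f T)) - min_value d f)) \<le> ereal \<epsilon>"
    using T(2) by (intro SUP_least) simp
  then have TA: "enat T \<in> A" unfolding A_def using T(1) by blast
  have "ereal_of_enat (Inf A) \<le> ereal_of_enat (enat T)"
    unfolding ereal_of_enat_le_iff by (rule Inf_lower[OF TA])
  then show "ereal_of_enat (exact_value_complexity d R \<mu> \<beta> \<epsilon>)
         \<le> ereal (36 * real d * sqrt \<kappa> * (1 + ln (\<mu> * R\<^sup>2 / \<epsilon>)))"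
    unfolding N using T(3) by (simp add: order_trans)
  \<comment> \<open>A nonempty set of extended naturals attains its infimum, so the lower bound can
    be applied to an optimal algorithm.\<close>
  have "Inf A \<in> A" using TA unfolding Inf_enat_def by (auto intro: LeastI)
  then obtain T' Q' Qout' where T': "Inf A = enat T'" "algorithm d R T' Q' Qout'"
    "(SUP f\<in>obj_class d R \<mu> \<beta>. ereal (f (Qout' (run Q' f T')) - min_value d f)) \<le> ereal \<epsilon>"
    unfolding A_def by auto
  have "f (Qout' (run Q' f T')) - min_value d f \<le> \<epsilon>" if "f \<in> obj_class d R \<mu> \<beta>" for f
    using T'(3) that by (simp add: SUP_le_iff)
  then have "1 / 1024 * real d * sqrt \<kappa> \<le> real T'"
    using lower_bound[OF T'(2) _ R \<mu> \<kappa> d \<kappa>_le \<epsilon>(2)] by blast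
  then show "ereal (1 / 1024 * real d * sqrt \<kappa>)
      \<le> ereal_of_enat (exact_value_complexity d R \<mu> \<beta> \<epsilon>)"
    unfolding N T'(1) by simp
qed auto

end
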